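(* Let $M$ be a nonempty smooth manifold of positive dimension, let $(M,J,g)$ be an $(\alpha,\varepsilon)$-metric manifold with $\alpha=-1$, and let $\mathcal G_g$ be the generalized metric on $\mathbb TM=TM\oplus T^*M$ induced by $g$. Then the generalized almost paracomplex structure $$\mathcal F_{J,g}=\begin{pmatrix}J&\sqrt2\,\sharp_g\\ \sqrt2\,\flat_g&\varepsilon J^*\end{pmatrix}$$ is compatible with $\mathcal G_g$ if and only if $\varepsilon=-1$, that is, if and only if $(M,J,g)$ is an almost Norden manifold. In this case, $(\mathcal F_{J,g},\mathcal G_g)$ is a generalized pseudo-Riemannian almost product structure and, writing $\phi(\cdot,\cdot)=g(J\cdot,\cdot)$ for the twin metric of $(M,J,g)$, the twin metric of $(\mathcal F_{J,g},\mathcal G_g)$ is $$\Phi_{\mathcal F_{J,g}}(X+\xi,Y+\eta)=2\sqrt2\,\mathcal G_0(X+\xi,Y+\eta)+\phi(X,Y)+\phi(\sharp_\phi\xi,\sharp_\phi\eta)$$ for all $X,Y\in\mathfrak X(M)$, $\xi,\eta\in\Lambda^1(M)$.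
   Context: An $(\alpha,\varepsilon)$-metric manifold $(M,J,g)$, $\alpha,\varepsilon\in\{+1,-1\}$, is a smooth manifold with a Riemannian or pseudo-Riemannian (i.e. nondegenerate, not positive definite) metric $g$ and an $\mathfrak F(M)$-linear $J\colon\mathfrak X(M)\to\mathfrak X(M)$ with $J^2=\alpha Id$ and $g(JX,JY)=\varepsilon g(X,Y)$ for all $X,Y$. For $\alpha=\varepsilon=-1$ it is called almost Norden. $\mathfrak F(M)$, $\mathfrak X(M)$, $\Lambda^1(M)$ denote smooth functions, vector fields, 1-forms; sections of $\mathbb TM$ are written $X+\xi$. For a nondegenerate bilinear form $b$ on $M$: $(\flat_bX)(Y)=b(X,Y)$, $\sharp_b=\flat_b^{-1}$. $(J^*\xi)(X)=\xi(JX)$. Matrix notation: $\begin{pmatrix}H&\sigma\\ \tau&K\end{pmatrix}(X+\xi)=(HX+\sigma\xi)+(\tau X+K\xi)$. $\mathcal G_g(X+\xi,Y+\eta)=g(X,Y)+g(\sharp_g\xi,\sharp_g\eta)$; $\mathcal G_0(X+\xi,Y+\eta)=\frac12(\xi(Y)+\eta(X))$. A generalized almost paracomplex structure is an $\mathfrak F(M)$-linear endomorphism $\mathcal F$ of $\Gamma(\mathbb TM)$ with $\mathcal F^2=Id$ whose $\pm1$-eigenbundles have equal rank. Compatible means: there is $\delta\in\{+1,-1\}$ with $\mathcal G(\mathcal Ku,\mathcal Kv)=\delta\,\mathcal G(u,v)$ for all sections $u,v$. $(\mathcal F,\mathcal G)$ with $\mathcal F^2=Id$ and $\mathcal G$ pseudo-Riemannian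 is generalized pseudo-Riemannian almost product if $\mathcal G(\mathcal Fu,\mathcal Fv)=\mathcal G(u,v)$ for all $u,v$; its twin metric is $\Phi_{\mathcal F}(u,v)=\mathcal G(\mathcal Fu,v)$ (here with $\mathcal G=\mathcal G_g$). *)

theory Defs
  imports "HOL-Analysis.Analysis" "HOL-Library.Function_Algebras"
begin

instantiation "fun" :: (type, real_vector) real_vector
begin

definition scaleR_fun :: "real \<Rightarrow> ('a \<Rightarrow> 'b) \<Rightarrow> 'a \<Rightarrow> 'b" where
  "scaleR_fun c f = (\<lambda>x. c *\<^sub>R f x)"

instance
  by standard (simp_all add: scaleR_fun_def fun_eq_iff scaleR_add_right scaleR_add_left)

end


subsection \<open>Smooth manifolds\<close>

primrec Ck_on :: "nat \<Rightarrow> 'e::real_normed_vector set \<Rightarrow> ('e \<Rightarrow> 'f::real_normed_vector) \<Rightarrow> bool" where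
  "Ck_on 0 S f \<longleftrightarrow> continuous_on S f"
| "Ck_on (Suc k) S f \<longleftrightarrow> (\<forall>x\<in>S. f differentiable (at x)) \<and>
     (\<forall>v. Ck_on k S (\<lambda>x. frechet_derivative f (at x) v))"

text \<open>Only used for open \<open>S\<close>.\<close>

definition smooth_on :: "'e::real_normed_vector set \<Rightarrow> ('e \<Rightarrow> 'f::real_normed_vector) \<Rightarrow> bool" where
  "smooth_on S f \<longleftrightarrow> (\<forall>k. Ck_on k S f)"

type_synonym ('m, 'e) chart = "'m set \<times> ('m \<Rightarrow> 'e)"

text \<open>
  The manifold is the whole type \<open>'m\<close>, hence nonempty; its dimension is \<open>DIM('e)\<close>, hence positive.
  The smooth structure is the one generated by the atlas.
\<close>

definition smooth_manifold ::
    "('m::{t2_space, second_countable_topology}, 'e::euclidean_space) chart set \<Rightarrow> bool" where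
  "smooth_manifold A \<longleftrightarrow>
     (\<forall>(U, x)\<in>A. open U \<and> open (x ` U) \<and> (\<exists>y. homeomorphism U (x ` U) x y)) \<and>
     (\<Union>(U, x)\<in>A. U) = UNIV \<and>
     (\<forall>(U, x)\<in>A. \<forall>(V, y)\<in>A. smooth_on (x ` (U \<inter> V)) (y \<circ> the_inv_into U x))"

definition smooth_functions :: "('m, 'e::euclidean_space) chart set \<Rightarrow> ('m \<Rightarrow> real) set" where
  "smooth_functions A = {f. \<forall>(U, x)\<in>A. smooth_on (x ` U) (f \<circ> the_inv_into U x)}"


subsection \<open>Vector fields, 1-forms and sections of the generalized tangent bundle\<close>

text \<open>
  Vector fields are the derivations of the algebra of smooth functions, and 1-forms are the
  function-linear maps from vector fields to smooth functions. Both are extended by \<open>0\<close> outside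
  their domain, so that equality of HOL functions is equality of fields.
\<close>

type_synonym 'm vector_field = "('m \<Rightarrow> real) \<Rightarrow> 'm \<Rightarrow> real"
type_synonym 'm one_form = "'m vector_field \<Rightarrow> 'm \<Rightarrow> real"
type_synonym 'm gen_section = "'m vector_field \<times> 'm one_form"

definition fsmul :: "('m \<Rightarrow> real) \<Rightarrow> ('b \<Rightarrow> 'm \<Rightarrow> real) \<Rightarrow> 'b \<Rightarrow> 'm \<Rightarrow> real" where
  "fsmul f X = (\<lambda>y. f * X y)"

definition vector_fields :: "('m, 'e::euclidean_space) chart set \<Rightarrow> 'm vector_field set" where
  "vector_fields A = {X.
     (\<forall>f\<in>smooth_functions A. X f \<in> smooth_functions A) \<and>
     (\<forall>f\<in>smooth_functions A. \<forall>h\<in>smooth_functions A. X (f + h) = X f + X h) \<and>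
     (\<forall>c. \<forall>f\<in>smooth_functions A. X (c *\<^sub>R f) = c *\<^sub>R X f) \<and>
     (\<forall>f\<in>smooth_functions A. \<forall>h\<in>smooth_functions A. X (f * h) = f * X h + h * X f) \<and>
     (\<forall>f. f \<notin> smooth_functions A \<longrightarrow> X f = 0)}"

definition one_forms :: "('m, 'e::euclidean_space) chart set \<Rightarrow> 'm one_form set" where
  "one_forms A = {\<xi>.
     (\<forall>X\<in>vector_fields A. \<xi> X \<in> smooth_functions A) \<and>
     (\<forall>X\<in>vector_fields A. \<forall>Y\<in>vector_fields A. \<xi> (X + Y) = \<xi> X + \<xi> Y) \<and>
     (\<forall>f\<in>smooth_functions A. \<forall>X\<in>vector_fields A. \<xi> (fsmul f X) = f * \<xi> X) \<and>
     (\<forall>X. X \<notin> vector_fields A \<longrightarrow> \<xi> X = 0)}"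

text \<open>The pair \<open>(X, \<xi>)\<close> is the section \<open>X + \<xi>\<close>.\<close>

definition gen_sections :: "('m, 'e::euclidean_space) chart set \<Rightarrow> 'm gen_section set" where
  "gen_sections A = vector_fields A \<times> one_forms A"

definition gen_fsmul :: "('m \<Rightarrow> real) \<Rightarrow> 'm gen_section \<Rightarrow> 'm gen_section" where
  "gen_fsmul f u = (fsmul f (fst u), fsmul f (snd u))"

text \<open>
  Values at a point: \<open>value_at p X\<close> is the tangent vector \<open>f \<mapsto> (X f)(p)\<close>, and \<open>value_at p \<xi>\<close> is
  the covector \<open>X \<mapsto> \<xi>(X)(p)\<close>, which depends on \<open>X\<close> only through its value at \<open>p\<close>. Every element
  of a fibre is the value of a global section, so the fibre at \<open>p\<close> is the set of these values.
\<close>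

definition value_at :: "'m \<Rightarrow> ('b \<Rightarrow> 'm \<Rightarrow> real) \<Rightarrow> 'b \<Rightarrow> real" where
  "value_at p X = (\<lambda>y. X y p)"

definition gen_value_at ::
    "'m \<Rightarrow> 'm gen_section \<Rightarrow> (('m \<Rightarrow> real) \<Rightarrow> real) \<times> ('m vector_field \<Rightarrow> real)" where
  "gen_value_at p u = (value_at p (fst u), value_at p (snd u))"


subsection \<open>Endomorphisms and metrics\<close>

text \<open>
  These notions serve both the tangent and the generalized tangent bundle. The bundle enters through
  its set \<open>S\<close> of sections, the multiplication \<open>sm\<close> of sections by functions, and the evaluation \<open>ev\<close>
  of sections at points; \<open>F\<close> is the algebra of smooth functions.
\<close>

definition F_linear ::
    "('m \<Rightarrow> real) set \<Rightarrow> 's::plus set \<Rightarrow> (('m \<Rightarrow> real) \<Rightarrow> 's \<Rightarrow> 's) \<Rightarrow> ('s \<Rightarrow> 's) \<Rightarrow> bool" where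
  "F_linear F S sm T \<longleftrightarrow>
     (\<forall>u\<in>S. T u \<in> S) \<and>
     (\<forall>u\<in>S. \<forall>v\<in>S. T (u + v) = T u + T v) \<and>
     (\<forall>f\<in>F. \<forall>u\<in>S. T (sm f u) = sm f (T u))"

definition F_bilinear ::
    "('m \<Rightarrow> real) set \<Rightarrow> 's::plus set \<Rightarrow> (('m \<Rightarrow> real) \<Rightarrow> 's \<Rightarrow> 's) \<Rightarrow>
     ('s \<Rightarrow> 's \<Rightarrow> 'm \<Rightarrow> real) \<Rightarrow> bool" where
  "F_bilinear F S sm b \<longleftrightarrow>
     (\<forall>u\<in>S. \<forall>v\<in>S. b u v \<in> F) \<and>
     (\<forall>u\<in>S. \<forall>v\<in>S. \<forall>w\<in>S. b (u + v) w = b u w + b v w \<and> b w (u + v) = b w u + b w v) \<and>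
     (\<forall>f\<in>F. \<forall>u\<in>S. \<forall>v\<in>S. b (sm f u) v = f * b u v \<and> b u (sm f v) = f * b u v)"

definition nondegenerate ::
    "'s set \<Rightarrow> ('m \<Rightarrow> 's \<Rightarrow> 'v::zero) \<Rightarrow> ('s \<Rightarrow> 's \<Rightarrow> 'm \<Rightarrow> real) \<Rightarrow> bool" where
  "nondegenerate S ev b \<longleftrightarrow> (\<forall>p. \<forall>u\<in>S. (\<forall>v\<in>S. b u v p = 0) \<longrightarrow> ev p u = 0)"

definition positive_definite ::
    "'s set \<Rightarrow> ('m \<Rightarrow> 's \<Rightarrow> 'v::zero) \<Rightarrow> ('s \<Rightarrow> 's \<Rightarrow> 'm \<Rightarrow> real) \<Rightarrow> bool" where
  "positive_definite S ev b \<longleftrightarrow> (\<forall>p. \<forall>u\<in>S. ev p u \<noteq> 0 \<longrightarrow> b u u p > 0)"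

definition riemannian_metric ::
    "('m \<Rightarrow> real) set \<Rightarrow> 's::plus set \<Rightarrow> (('m \<Rightarrow> real) \<Rightarrow> 's \<Rightarrow> 's) \<Rightarrow> ('m \<Rightarrow> 's \<Rightarrow> 'v::zero) \<Rightarrow>
     ('s \<Rightarrow> 's \<Rightarrow> 'm \<Rightarrow> real) \<Rightarrow> bool" where
  "riemannian_metric F S sm ev b \<longleftrightarrow>
     F_bilinear F S sm b \<and> (\<forall>u\<in>S. \<forall>v\<in>S. b u v = b v u) \<and> positive_definite S ev b"

definition pseudo_riemannian_metric ::
    "('m \<Rightarrow> real) set \<Rightarrow> 's::plus set \<Rightarrow> (('m \<Rightarrow> real) \<Rightarrow> 's \<Rightarrow> 's) \<Rightarrow> ('m \<Rightarrow> 's \<Rightarrow> 'v::zero) \<Rightarrow>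
     ('s \<Rightarrow> 's \<Rightarrow> 'm \<Rightarrow> real) \<Rightarrow> bool" where
  "pseudo_riemannian_metric F S sm ev b \<longleftrightarrow>
     F_bilinear F S sm b \<and> (\<forall>u\<in>S. \<forall>v\<in>S. b u v = b v u) \<and>
     nondegenerate S ev b \<and> \<not> positive_definite S ev b"

definition twin_metric :: "('s \<Rightarrow> 's \<Rightarrow> 'm \<Rightarrow> real) \<Rightarrow> ('s \<Rightarrow> 's) \<Rightarrow> 's \<Rightarrow> 's \<Rightarrow> 'm \<Rightarrow> real" where
  "twin_metric b T u v = b (T u) v"


subsection \<open>Metric manifolds\<close>

definition metric_manifold ::
    "('m::{t2_space, second_countable_topology}, 'e::euclidean_space) chart set \<Rightarrow> real \<Rightarrow> real \<Rightarrow>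
     ('m vector_field \<Rightarrow> 'm vector_field) \<Rightarrow>
     ('m vector_field \<Rightarrow> 'm vector_field \<Rightarrow> 'm \<Rightarrow> real) \<Rightarrow> bool" where
  "metric_manifold A \<alpha> \<epsilon> J g \<longleftrightarrow>
     smooth_manifold A \<and> \<alpha> \<in> {1, -1} \<and> \<epsilon> \<in> {1, -1} \<and>
     (riemannian_metric (smooth_functions A) (vector_fields A) fsmul value_at g \<or>
      pseudo_riemannian_metric (smooth_functions A) (vector_fields A) fsmul value_at g) \<and>
     F_linear (smooth_functions A) (vector_fields A) fsmul J \<and>
     (\<forall>X\<in>vector_fields A. J (J X) = \<alpha> *\<^sub>R X) \<and>
     (\<forall>X\<in>vector_fields A. \<forall>Y\<in>vector_fields A. g (J X) (J Y) = \<epsilon> *\<^sub>R g X Y)"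

definition almost_norden ::
    "('m::{t2_space, second_countable_topology}, 'e::euclidean_space) chart set \<Rightarrow>
     ('m vector_field \<Rightarrow> 'm vector_field) \<Rightarrow>
     ('m vector_field \<Rightarrow> 'm vector_field \<Rightarrow> 'm \<Rightarrow> real) \<Rightarrow> bool" where
  "almost_norden A J g \<longleftrightarrow> metric_manifold A (-1) (-1) J g"

definition flat ::
    "('m, 'e::euclidean_space) chart set \<Rightarrow>
     ('m vector_field \<Rightarrow> 'm vector_field \<Rightarrow> 'm \<Rightarrow> real) \<Rightarrow> 'm vector_field \<Rightarrow> 'm one_form" where
  "flat A b X = (\<lambda>Y. if Y \<in> vector_fields A then b X Y else 0)"

definition sharp ::
    "('m, 'e::euclidean_space) chart set \<Rightarrow>
     ('m vector_field \<Rightarrow> 'm vector_field \<Rightarrow> 'm \<Rightarrow> real) \<Rightarrow> 'm one_form \<Rightarrow> 'm vector_field" where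
  "sharp A b = the_inv_into (vector_fields A) (flat A b)"

definition dual_map ::
    "('m, 'e::euclidean_space) chart set \<Rightarrow> ('m vector_field \<Rightarrow> 'm vector_field) \<Rightarrow>
     'm one_form \<Rightarrow> 'm one_form" where
  "dual_map A J \<xi> = (\<lambda>X. if X \<in> vector_fields A then \<xi> (J X) else 0)"


subsection \<open>Generalized structures\<close>

definition gen_matrix ::
    "('m vector_field \<Rightarrow> 'm vector_field) \<Rightarrow> ('m one_form \<Rightarrow> 'm vector_field) \<Rightarrow>
     ('m vector_field \<Rightarrow> 'm one_form) \<Rightarrow> ('m one_form \<Rightarrow> 'm one_form) \<Rightarrow>
     'm gen_section \<Rightarrow> 'm gen_section" where
  "gen_matrix H \<sigma> \<tau> K = (\<lambda>(X, \<xi>). (H X + \<sigma> \<xi>, \<tau> X + K \<xi>))"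

definition gen_metric ::
    "('m, 'e::euclidean_space) chart set \<Rightarrow>
     ('m vector_field \<Rightarrow> 'm vector_field \<Rightarrow> 'm \<Rightarrow> real) \<Rightarrow>
     'm gen_section \<Rightarrow> 'm gen_section \<Rightarrow> 'm \<Rightarrow> real" where
  "gen_metric A g = (\<lambda>(X, \<xi>) (Y, \<eta>). g X Y + g (sharp A g \<xi>) (sharp A g \<eta>))"

definition gen_metric0 :: "'m gen_section \<Rightarrow> 'm gen_section \<Rightarrow> 'm \<Rightarrow> real" where
  "gen_metric0 = (\<lambda>(X, \<xi>) (Y, \<eta>). (1/2) *\<^sub>R (\<xi> Y + \<eta> X))"

definition gen_F ::
    "('m, 'e::euclidean_space) chart set \<Rightarrow> real \<Rightarrow> ('m vector_field \<Rightarrow> 'm vector_field) \<Rightarrow>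
     ('m vector_field \<Rightarrow> 'm vector_field \<Rightarrow> 'm \<Rightarrow> real) \<Rightarrow> 'm gen_section \<Rightarrow> 'm gen_section" where
  "gen_F A \<epsilon> J g = gen_matrix
     J                              (\<lambda>\<xi>. sqrt 2 *\<^sub>R sharp A g \<xi>)
     (\<lambda>X. sqrt 2 *\<^sub>R flat A g X)    (\<lambda>\<xi>. \<epsilon> *\<^sub>R dual_map A J \<xi>)"

text \<open>
  The fibre at \<open>p\<close> of the eigenbundle, as the set of values of its sections. For \<open>T\<^sup>2 = Id\<close> this is
  the eigenspace of \<open>T\<close> on the fibre at \<open>p\<close>, by means of the projections \<open>(Id \<plusminus> T)/2\<close>.
\<close>

definition gen_eigenfibre ::
    "('m, 'e::euclidean_space) chart set \<Rightarrow> ('m gen_section \<Rightarrow> 'm gen_section) \<Rightarrow> real \<Rightarrow> 'm \<Rightarrow>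
     ((('m \<Rightarrow> real) \<Rightarrow> real) \<times> ('m vector_field \<Rightarrow> real)) set" where
  "gen_eigenfibre A T c p = gen_value_at p ` {u \<in> gen_sections A. T u = c *\<^sub>R u}"

definition gen_almost_paracomplex ::
    "('m, 'e::euclidean_space) chart set \<Rightarrow> ('m gen_section \<Rightarrow> 'm gen_section) \<Rightarrow> bool" where
  "gen_almost_paracomplex A T \<longleftrightarrow>
     F_linear (smooth_functions A) (gen_sections A) gen_fsmul T \<and>
     (\<forall>u\<in>gen_sections A. T (T u) = u) \<and>
     (\<forall>p. dim (gen_eigenfibre A T 1 p) = dim (gen_eigenfibre A T (-1) p))"

definition gen_compatible ::
    "('m, 'e::euclidean_space) chart set \<Rightarrow> ('m gen_section \<Rightarrow> 'm gen_section) \<Rightarrow>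
     ('m gen_section \<Rightarrow> 'm gen_section \<Rightarrow> 'm \<Rightarrow> real) \<Rightarrow> bool" where
  "gen_compatible A T G \<longleftrightarrow>
     (\<exists>\<delta>\<in>{1, -1::real}. \<forall>u\<in>gen_sections A. \<forall>v\<in>gen_sections A. G (T u) (T v) = \<delta> *\<^sub>R G u v)"

definition gen_pseudo_riemannian_almost_product ::
    "('m, 'e::euclidean_space) chart set \<Rightarrow> ('m gen_section \<Rightarrow> 'm gen_section) \<Rightarrow>
     ('m gen_section \<Rightarrow> 'm gen_section \<Rightarrow> 'm \<Rightarrow> real) \<Rightarrow> bool" where
  "gen_pseudo_riemannian_almost_product A T G \<longleftrightarrow>
     F_linear (smooth_functions A) (gen_sections A) gen_fsmul T \<and>
     (\<forall>u\<in>gen_sections A. T (T u) = u) \<and>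
     pseudo_riemannian_metric (smooth_functions A) (gen_sections A) gen_fsmul gen_value_at G \<and>
     (\<forall>u\<in>gen_sections A. \<forall>v\<in>gen_sections A. G (T u) (T v) = G u v)"

end

theory Submission
  imports Defs
begin

text \<open>
  Because \<open>g(J X, Y) = -\<epsilon> g(X, J Y)\<close>, the identification of \<open>X + \<flat>\<^sub>g Z\<close> with \<open>(X, Z)\<close> turns \<open>gen_F\<close> into
  \<open>(X, Z) \<mapsto> (J X + \<surd>2 Z, \<surd>2 X - J Z)\<close> and \<open>gen_metric\<close> into \<open>g \<oplus> g\<close>; all claims are then short
  computations. In particular the \<open>\<plusminus>1\<close>-eigenbundles are the graphs of \<open>X \<mapsto> (\<plusminus>X - J X)/\<surd>2\<close>, and on
  \<open>TM\<close> the map scales \<open>g\<close> by \<open>\<epsilon> + 2\<close>, which is \<open>\<plusminus>1\<close> only for \<open>\<epsilon> = -1\<close>.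

  The substance lies in the bijectivity of \<open>\<flat>\<^sub>g\<close> for vector fields defined as derivations. Hadamard's
  lemma and bump functions show that every vector field is, near each point, a combination of the
  coordinate fields (cut off so as to be globally defined) with smooth coefficients. Hence
  function-linear maps are determined pointwise, and the local solutions of \<open>\<flat>\<^sub>g X = \<xi>\<close>, obtained by
  solving a linear system with smooth coefficients, are unique by nondegeneracy and glue.
\<close>

subsection \<open>Smooth functions on Euclidean spaces\<close>

text \<open>Taking derivations as vector fields means that every field, 1-form and function is
  global: there is no restriction to an open set. A local formula therefore has to be cut off before
  a derivation or a function-linear map can be applied to it, which is why the local lemmas are
  phrased with \<open>eventually\<close> and \<open>nhds\<close>, and why bump functions come before
  any tensor calculus. Their extension by zero relies on the Hausdorff property. Gluing the
  solutions of \<open>\<flat>\<^sub>g X = \<xi>\<close> needs no partition of unity, because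
  uniqueness already holds at each single point. The sign \<open>\<epsilon> = -1\<close> acts in two
  ways. It makes \<open>J\<close> self-adjoint for \<open>g\<close>, which removes the mixed terms
  in the compatibility identity and fixes the sign of the covector part of the twin metric. It also
  makes \<open>J\<close> an anti-isometry, so that \<open>g\<close>, and with it the generalized
  metric, cannot be positive definite.\<close>

lemma Ck_on_subset: "Ck_on k S f \<Longrightarrow> T \<subseteq> S \<Longrightarrow> Ck_on k T f"
  by (induction k arbitrary: f) (auto intro: continuous_on_subset)

lemma Ck_on_Suc_has_derivative:
  "Ck_on (Suc k) S f \<Longrightarrow> x \<in> S \<Longrightarrow> (f has_derivative frechet_derivative f (at x)) (at x)"
  using frechet_derivative_works by auto

text \<open>Openness matters: \<open>frechet_derivative f (at x)\<close> depends on a full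
  neighbourhood of \<open>x\<close>, so equality on \<open>S\<close> passes to the derivatives only
  for open \<open>S\<close>.\<close>

lemma Ck_on_cong:
  assumes "open S" "\<And>x. x \<in> S \<Longrightarrow> f x = g x" "Ck_on k S f"
  shows "Ck_on k S g"
  using assms(2,3)
proof (induction k arbitrary: f g)
  case 0
  then show ?case using continuous_on_cong[of S S f g] by simp
next
  case (Suc k)
  have d: "(g has_derivative frechet_derivative f (at x)) (at x)" if "x \<in> S" for x
    by (rule has_derivative_transform_within_open[OF Ck_on_Suc_has_derivative[OF Suc.prems(2) that]
        assms(1) that Suc.prems(1)])
  have "Ck_on k S (\<lambda>x. frechet_derivative g (at x) v)" for v
  proof (rule Suc.IH)
    show "frechet_derivative f (at x) v = frechet_derivative g (at x) v" if "x \<in> S" for x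
      using frechet_derivative_at[OF d[OF that]] by simp
    show "Ck_on k S (\<lambda>x. frechet_derivative f (at x) v)"
      using Suc.prems(2) by simp
  qed
  then show ?case using d by (auto simp: differentiable_def)
qed

text \<open>Any explicit derivative may stand in for \<open>frechet_derivative\<close>; the closure
  lemmas can thus feed the standard differentiation rules into an induction on
  \<open>k\<close>.\<close>

lemma Ck_on_SucI:
  assumes "open S" "\<And>x. x \<in> S \<Longrightarrow> (f has_derivative f' x) (at x)" "\<And>v. Ck_on k S (\<lambda>x. f' x v)"
  shows "Ck_on (Suc k) S f"
proof -
  have "Ck_on k S (\<lambda>x. frechet_derivative f (at x) v)" for v
    by (rule Ck_on_cong[OF assms(1) _ assms(3)[of v]]) (metis assms(2) frechet_derivative_at)
  then show ?thesis using assms(2) by (auto simp: differentiable_def)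
qed

text \<open>Product, quotient and chain rules leave undifferentiated factors, whose order has to be
  lowered by one before the induction hypothesis applies.\<close>

lemma Ck_on_SucD:
  assumes "Ck_on (Suc k) S f"
  shows "Ck_on k S f"
  using assms
proof (induction k arbitrary: f)
  case 0
  then show ?case
    by (simp add: continuous_at_imp_continuous_on differentiable_imp_continuous_within)
next
  case (Suc k)
  then show ?case using Ck_on.simps(2)[of k S] Ck_on.simps(2)[of "Suc k" S] by blast
qed

lemma Ck_on_local:
  assumes "\<And>x. x \<in> S \<Longrightarrow> \<exists>T. open T \<and> x \<in> T \<and> Ck_on k T f"
  shows "Ck_on k S f"
  using assms
proof (induction k arbitrary: f)
  case 0
  then show ?case
    by (metis Ck_on.simps(1) continuous_at_imp_continuous_on continuous_on_eq_continuous_at)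
next
  case (Suc k)
  have "Ck_on k S (\<lambda>x. frechet_derivative f (at x) v)" for v
    by (rule Suc.IH) (use Suc.prems in fastforce)
  then show ?case using Suc.prems by fastforce
qed

lemma Ck_on_const: "open S \<Longrightarrow> Ck_on k S (\<lambda>x. c)"
proof (induction k arbitrary: c)
  case (Suc k)
  show ?case
    by (rule Ck_on_SucI[where f'="\<lambda>_ _. 0"]) (use Suc in auto)
qed simp

lemma Ck_on_bounded_linear:
  assumes "open S" "bounded_linear f"
  shows "Ck_on k S f"
proof (cases k)
  case 0
  then show ?thesis
    using linear_continuous_on[OF assms(2)] by simp
next
  case (Suc j)
  show ?thesis unfolding Suc
    by (rule Ck_on_SucI[OF assms(1) bounded_linear_imp_has_derivative[OF assms(2)]])
      (rule Ck_on_const[OF assms(1)])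
qed

lemma Ck_on_bounded_linear_compose:
  assumes "open S" "bounded_linear h" "Ck_on k S f"
  shows "Ck_on k S (\<lambda>x. h (f x))"
  using assms(3)
proof (induction k arbitrary: f)
  case 0
  then show ?case using bounded_linear.continuous_on[OF assms(2)] by simp
next
  case (Suc k)
  show ?case
    by (rule Ck_on_SucI[OF assms(1)
          bounded_linear.has_derivative[OF assms(2) Ck_on_Suc_has_derivative[OF Suc.prems]]])
      (use Suc in auto)
qed

lemma Ck_on_add:
  assumes "open S" "Ck_on k S f" "Ck_on k S g"
  shows "Ck_on k S (\<lambda>x. f x + g x)"
  using assms(2,3)
proof (induction k arbitrary: f g)
  case 0
  then show ?case by (auto intro: continuous_intros)
next
  case (Suc k)
  show ?case
    by (rule Ck_on_SucI[OF assms(1)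
          has_derivative_add[OF Ck_on_Suc_has_derivative[OF Suc.prems(1)]
                                Ck_on_Suc_has_derivative[OF Suc.prems(2)]]])
      (use Suc in auto)
qed

lemma Ck_on_sum:
  assumes "open S" "\<And>i. i \<in> I \<Longrightarrow> Ck_on k S (f i)"
  shows "Ck_on k S (\<lambda>x. \<Sum>i\<in>I. f i x)"
  using assms(2)
  by (induction I rule: infinite_finite_induct) (auto intro: Ck_on_const Ck_on_add assms(1))

lemma Ck_on_mult:
  fixes f g :: "'e::real_normed_vector \<Rightarrow> real"
  assumes "open S" "Ck_on k S f" "Ck_on k S g"
  shows "Ck_on k S (\<lambda>x. f x * g x)"
  using assms(2,3)
proof (induction k arbitrary: f g)
  case 0
  then show ?case by (auto intro: continuous_intros)
next
  case (Suc k)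
  show ?case
    by (rule Ck_on_SucI[OF assms(1)
          has_derivative_mult[OF Ck_on_Suc_has_derivative[OF Suc.prems(1)]
                                 Ck_on_Suc_has_derivative[OF Suc.prems(2)]]])
      (use Suc Suc.prems[THEN Ck_on_SucD] in \<open>auto intro!: Ck_on_add assms(1)\<close>)
qed

lemma Ck_on_inverse:
  fixes f :: "'e::real_normed_vector \<Rightarrow> real"
  assumes "open S" "Ck_on k S f" "\<And>x. x \<in> S \<Longrightarrow> f x \<noteq> 0"
  shows "Ck_on k S (\<lambda>x. inverse (f x))"
  using assms(2)
proof (induction k)
  case 0
  then show ?case using assms(3) by (auto intro: continuous_intros)
next
  case (Suc k)
  note I = Suc.IH[OF Ck_on_SucD[OF Suc.prems]]
  show ?case
  proof (rule Ck_on_SucI[OF assms(1)])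
    show "((\<lambda>x. inverse (f x)) has_derivative
        (\<lambda>h. - (inverse (f x) * frechet_derivative f (at x) h * inverse (f x)))) (at x)"
      if "x \<in> S" for x
      by (rule Deriv.has_derivative_inverse[OF assms(3)[OF that] Ck_on_Suc_has_derivative[OF Suc.prems that]])
    have "Ck_on k S (\<lambda>x. (-1) * (inverse (f x) * frechet_derivative f (at x) v * inverse (f x)))" for v
      using Suc.prems by (intro Ck_on_mult assms(1) I Ck_on_const) auto
    then show "Ck_on k S (\<lambda>x. - (inverse (f x) * frechet_derivative f (at x) v * inverse (f x)))" for v
      by simp
  qed
qed

lemma Ck_on_compose:
  fixes g :: "'e::real_normed_vector \<Rightarrow> 'f::euclidean_space" and f :: "'f \<Rightarrow> real"
  assumes "open S" "open T" "g ` S \<subseteq> T" "Ck_on k T f" "Ck_on k S g"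
  shows "Ck_on k S (\<lambda>x. f (g x))"
  using assms(4,5)
proof (induction k arbitrary: f)
  case 0
  then show ?case using continuous_on_compose2[of T f S g] assms(3) by simp
next
  case (Suc k)
  let ?f = "\<lambda>y. frechet_derivative f (at y)" and ?g = "\<lambda>x. frechet_derivative g (at x)"
  have gT: "g x \<in> T" if "x \<in> S" for x using that assms(3) by auto
  show ?case
  proof (rule Ck_on_SucI[OF assms(1)])
    fix x assume x: "x \<in> S"
    have df: "(f has_derivative ?f (g x)) (at (g x))"
      using Ck_on_Suc_has_derivative[OF Suc.prems(1) gT[OF x]] .
    have chain: "((\<lambda>x. f (g x)) has_derivative (\<lambda>v. ?f (g x) (?g x v))) (at x)"
      using diff_chain_at[OF Ck_on_Suc_has_derivative[OF Suc.prems(2) x] df] by (simp add: o_def)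
    \<comment> \<open>\<open>Ck_on\<close> controls derivatives in fixed directions only, whereas
      the chain rule evaluates the derivative of \<open>f\<close> in the moving direction
      \<open>?g x v\<close>. Expanding that direction in the basis leaves products of functions of
      class \<open>k\<close>.\<close>
    have expand: "?f (g x) w = (\<Sum>b\<in>Basis. (w \<bullet> b) * ?f (g x) b)" for w
    proof -
      have "linear (?f (g x))" using df by (rule has_derivative_linear)
      then show ?thesis
        by (subst euclidean_representation[of w, symmetric])
          (simp add: linear_sum linear_cmul del: euclidean_representation)
    qed
    show "((\<lambda>x. f (g x)) has_derivative
        (\<lambda>v. \<Sum>b\<in>Basis. (?g x v \<bullet> b) * ?f (g x) b)) (at x)"
      by (rule has_derivative_eq_rhs[OF chain ext[OF expand]])
  next
    fix v
    show "Ck_on k S (\<lambda>x. \<Sum>b\<in>Basis. (?g x v \<bullet> b) * ?f (g x) b)"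
    proof (intro Ck_on_sum Ck_on_mult assms(1))
      fix b :: 'f
      show "Ck_on k S (\<lambda>x. ?g x v \<bullet> b)"
        using Suc.prems(2)
        by (intro Ck_on_bounded_linear_compose[OF assms(1) bounded_linear_inner_left]) simp
      show "Ck_on k S (\<lambda>x. ?f (g x) b)"
        using Suc.prems Ck_on_SucD[OF Suc.prems(2)] by (intro Suc.IH) auto
    qed
  qed
qed

lemma smooth_on_subset: "smooth_on S f \<Longrightarrow> T \<subseteq> S \<Longrightarrow> smooth_on T f"
  by (auto simp: smooth_on_def intro: Ck_on_subset)

lemma smooth_on_cong:
  "open S \<Longrightarrow> (\<And>x. x \<in> S \<Longrightarrow> f x = g x) \<Longrightarrow> smooth_on S f \<Longrightarrow> smooth_on S g"
  unfolding smooth_on_def using Ck_on_cong by blast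

lemma smooth_on_local:
  assumes "\<And>x. x \<in> S \<Longrightarrow> \<exists>T. open T \<and> x \<in> T \<and> smooth_on T f"
  shows "smooth_on S f"
  unfolding smooth_on_def using assms by (intro allI Ck_on_local) (metis smooth_on_def)

lemma smooth_on_const: "open S \<Longrightarrow> smooth_on S (\<lambda>x. c)"
  by (simp add: smooth_on_def Ck_on_const)

lemma smooth_on_bounded_linear: "open S \<Longrightarrow> bounded_linear f \<Longrightarrow> smooth_on S f"
  by (simp add: smooth_on_def Ck_on_bounded_linear)

lemma smooth_on_add:
  "open S \<Longrightarrow> smooth_on S f \<Longrightarrow> smooth_on S g \<Longrightarrow> smooth_on S (\<lambda>x. f x + g x)"
  by (simp add: smooth_on_def Ck_on_add)

lemma smooth_on_sum:
  "open S \<Longrightarrow> (\<And>i. i \<in> I \<Longrightarrow> smooth_on S (f i)) \<Longrightarrow> smooth_on S (\<lambda>x. \<Sum>i\<in>I. f i x)"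
  by (simp add: smooth_on_def Ck_on_sum)

lemma smooth_on_mult:
  fixes f g :: "'e::real_normed_vector \<Rightarrow> real"
  shows "open S \<Longrightarrow> smooth_on S f \<Longrightarrow> smooth_on S g \<Longrightarrow> smooth_on S (\<lambda>x. f x * g x)"
  by (simp add: smooth_on_def Ck_on_mult)

lemma smooth_on_inverse:
  fixes f :: "'e::real_normed_vector \<Rightarrow> real"
  shows "open S \<Longrightarrow> smooth_on S f \<Longrightarrow> (\<And>x. x \<in> S \<Longrightarrow> f x \<noteq> 0) \<Longrightarrow> smooth_on S (\<lambda>x. inverse (f x))"
  by (simp add: smooth_on_def Ck_on_inverse)

lemma smooth_on_compose:
  fixes g :: "'e::real_normed_vector \<Rightarrow> 'f::euclidean_space" and f :: "'f \<Rightarrow> real"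
  shows "open S \<Longrightarrow> open T \<Longrightarrow> g ` S \<subseteq> T \<Longrightarrow> smooth_on T f \<Longrightarrow> smooth_on S g \<Longrightarrow>
    smooth_on S (\<lambda>x. f (g x))"
  unfolding smooth_on_def using Ck_on_compose by blast

lemma smooth_on_frechet_derivative:
  "smooth_on S f \<Longrightarrow> smooth_on S (\<lambda>x. frechet_derivative f (at x) v)"
  unfolding smooth_on_def by (metis Ck_on.simps(2))

lemma smooth_on_has_derivative:
  "smooth_on S f \<Longrightarrow> x \<in> S \<Longrightarrow> (f has_derivative frechet_derivative f (at x)) (at x)"
  unfolding smooth_on_def using Ck_on_Suc_has_derivative by blast

lemma smooth_on_imp_continuous_on: "smooth_on S f \<Longrightarrow> continuous_on S f"
  unfolding smooth_on_def by (metis Ck_on.simps(1))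

section \<open>Flat functions and bump functions on Euclidean spaces\<close>

definition flat_exp :: "nat \<Rightarrow> real \<Rightarrow> real" where
  "flat_exp n t = (if t > 0 then inverse t ^ n * exp (- inverse t) else 0)"

lemma flat_exp_tendsto_0: "(flat_exp n \<longlongrightarrow> 0) (at 0)"
proof -
  have "((\<lambda>t::real. inverse t ^ n * exp (- inverse t)) \<longlongrightarrow> 0) (at_right 0)"
  proof -
    have "((\<lambda>s::real. s ^ n / exp s) \<longlongrightarrow> 0) at_top"
      by (rule tendsto_power_div_exp_0)
    then have "((\<lambda>t::real. inverse t ^ n / exp (inverse t)) \<longlongrightarrow> 0) (at_right 0)"
      by (rule filterlim_compose[OF _ filterlim_inverse_at_top_right])
    then show ?thesis by (simp add: exp_minus divide_inverse)
  qed
  then have "(flat_exp n \<longlongrightarrow> 0) (at_right 0)"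
    by (rule Lim_transform_eventually)
      (auto simp: eventually_at_filter flat_exp_def)
  moreover have "(flat_exp n \<longlongrightarrow> 0) (at_left 0)"
    by (rule Lim_transform_eventually[OF tendsto_const])
      (auto simp: eventually_at_filter flat_exp_def)
  ultimately show ?thesis by (rule filterlim_split_at[rotated])
qed

text \<open>The family is closed under differentiation up to linear combinations, so all its members
  are smooth by one induction with \<open>n\<close> arbitrary. Differentiating
  \<open>exp (- inverse t)\<close> adds two powers of \<open>inverse t\<close>, differentiating
  \<open>inverse t ^ n\<close> adds one.\<close>

lemma flat_exp_has_derivative:
  "(flat_exp n has_real_derivative (flat_exp (n + 2) t - real n * flat_exp (n + 1) t)) (at t)"
proof -
  consider "t > 0" | "t < 0" | "t = 0" by linarith
  then show ?thesis
  proof cases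
    case 1
    have "((\<lambda>t. inverse t ^ n * exp (- inverse t)) has_real_derivative
        (flat_exp (n + 2) t - real n * flat_exp (n + 1) t)) (at t)"
    proof -
      let ?u = "inverse t"
      have i: "(inverse has_real_derivative - (?u * ?u)) (at t)"
        using DERIV_inverse[of t] 1 by (simp add: numeral_2_eq_2)
      have "((\<lambda>t. inverse t ^ n) has_real_derivative real n * (- (?u * ?u) * ?u ^ (n - 1))) (at t)"
        using DERIV_power[OF i, of n] by simp
      moreover have "((\<lambda>t. exp (- inverse t)) has_real_derivative exp (- ?u) * (?u * ?u)) (at t)"
        using DERIV_chain2[OF DERIV_exp DERIV_minus[OF i]] by simp
      ultimately have "((\<lambda>t. inverse t ^ n * exp (- inverse t)) has_real_derivative
          real n * (- (?u * ?u) * ?u ^ (n - 1)) * exp (- ?u) + exp (- ?u) * (?u * ?u) * ?u ^ n) (at t)"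
        by (rule DERIV_mult)
      moreover have "real n * (- (?u * ?u) * ?u ^ (n - 1)) * exp (- ?u) + exp (- ?u) * (?u * ?u) * ?u ^ n
          = flat_exp (n + 2) t - real n * flat_exp (n + 1) t"
        \<comment> \<open>The subtraction \<open>n - 1\<close> truncates at \<open>n = 0\<close>,
          where the factor \<open>real n\<close> removes the term anyway.\<close>
        using 1 by (cases n) (auto simp: flat_exp_def algebra_simps simp del: power_inverse)
      ultimately show ?thesis by simp
    qed
    then show ?thesis
      by (rule has_field_derivative_transform_within_open[where S="{0<..}"])
        (use 1 in \<open>auto simp: flat_exp_def\<close>)
  next
    case 2
    have "((\<lambda>t. 0) has_real_derivative (flat_exp (n + 2) t - real n * flat_exp (n + 1) t)) (at t)"
      using 2 by (auto simp: flat_exp_def)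
    then show ?thesis
      by (rule has_field_derivative_transform_within_open[where S="{..<0}"])
        (use 2 in \<open>auto simp: flat_exp_def\<close>)
  next
    case 3
    \<comment> \<open>Since \<open>flat_exp n 0 = 0\<close>, the difference quotient at
      \<open>0\<close> is \<open>flat_exp (Suc n)\<close>: dividing by \<open>h\<close> only adds a
      power of \<open>inverse h\<close>.\<close>
    have "((\<lambda>h. (flat_exp n (0 + h) - flat_exp n 0) / h) \<longlongrightarrow> 0) (at 0)"
      by (rule Lim_transform_eventually[OF flat_exp_tendsto_0[of "Suc n"]])
        (auto simp: eventually_at_filter flat_exp_def field_simps)
    then show ?thesis unfolding 3 DERIV_def by (simp add: flat_exp_def)
  qed
qed

lemma smooth_on_flat_exp: "smooth_on UNIV (flat_exp n)"
proof -
  have "Ck_on k UNIV (flat_exp n)" for k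
  proof (induction k arbitrary: n)
    case 0
    then show ?case
      using flat_exp_has_derivative by (auto intro!: DERIV_continuous_on)
  next
    case (Suc k)
    show ?case
    proof (rule Ck_on_SucI)
      show "(flat_exp n has_derivative
          (\<lambda>v. (flat_exp (n + 2) t + (- real n) * flat_exp (n + 1) t) * v)) (at t)" for t
        using flat_exp_has_derivative[of n t] by (simp add: has_field_derivative_def)
    qed (intro Ck_on_mult Ck_on_add Ck_on_const Suc.IH open_UNIV)+
  qed
  then show ?thesis by (simp add: smooth_on_def)
qed

lemma flat_exp_nonneg: "flat_exp n t \<ge> 0"
  by (simp add: flat_exp_def)

lemma flat_exp_pos_iff: "flat_exp n t > 0 \<longleftrightarrow> t > 0"
  by (simp add: flat_exp_def)

text \<open>The bump is \<open>P / (P + Q)\<close>, with \<open>P\<close> positive exactly inside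
  radius \<open>2 * r\<close> and \<open>Q\<close> exactly outside radius \<open>r\<close>. These
  regions cover the space, so the denominator never vanishes. The squared distance is used because
  it is smooth at the centre as well.\<close>

lemma smooth_bump_exists:
  fixes a :: "'e::euclidean_space"
  assumes "r > 0"
  obtains \<beta> :: "'e \<Rightarrow> real" where "smooth_on UNIV \<beta>"
    "\<And>z. dist a z \<le> r \<Longrightarrow> \<beta> z = 1" "\<And>z. dist a z \<ge> 2 * r \<Longrightarrow> \<beta> z = 0"
proof
  define N where "N z = (\<Sum>b\<in>Basis. ((z - a) \<bullet> b) * ((z - a) \<bullet> b))" for z
  have N: "N z = (dist a z)\<^sup>2" for z
    unfolding N_def dist_norm norm_minus_commute[of a] power2_norm_eq_inner
    by (rule euclidean_inner[symmetric])
  have lin: "smooth_on UNIV (\<lambda>z. (z - a) \<bullet> b)" for b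
  proof -
    have "smooth_on UNIV (\<lambda>z. z \<bullet> b + - (a \<bullet> b))"
      by (intro smooth_on_add smooth_on_const smooth_on_bounded_linear bounded_linear_inner_left) auto
    then show ?thesis by (simp add: inner_diff_left)
  qed
  have sN: "smooth_on UNIV N"
    unfolding N_def by (intro smooth_on_sum smooth_on_mult lin) auto
  define P where "P z = flat_exp 0 (4 * r\<^sup>2 + (-1) * N z)" for z
  define Q where "Q z = flat_exp 0 (N z + (- r\<^sup>2))" for z
  have sP: "smooth_on UNIV P" unfolding P_def
    by (rule smooth_on_compose[OF _ _ _ smooth_on_flat_exp])
      (intro smooth_on_add smooth_on_mult smooth_on_const sN open_UNIV subset_UNIV)+
  have sQ: "smooth_on UNIV Q" unfolding Q_def
    by (rule smooth_on_compose[OF _ _ _ smooth_on_flat_exp])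
      (auto intro!: smooth_on_add smooth_on_const sN simp del: add_uminus_conv_diff)
  have r2: "r\<^sup>2 > 0" using assms by simp
  have pos: "P z + Q z \<noteq> 0" for z
  proof -
    have "P z > 0 \<or> Q z > 0"
      unfolding P_def Q_def flat_exp_pos_iff using r2 by linarith
    moreover have "P z \<ge> 0" "Q z \<ge> 0" by (simp_all add: P_def Q_def flat_exp_nonneg)
    ultimately show ?thesis by linarith
  qed
  show "smooth_on UNIV (\<lambda>z. P z * inverse (P z + Q z))"
    by (intro smooth_on_mult smooth_on_inverse smooth_on_add sP sQ) (auto simp: pos)
  show "P z * inverse (P z + Q z) = 1" if "dist a z \<le> r" for z
  proof -
    have "N z \<le> r\<^sup>2" using that by (simp add: N power_mono)
    then have "Q z = 0" by (simp add: Q_def flat_exp_def)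
    then show ?thesis using pos[of z] by simp
  qed
  show "P z * inverse (P z + Q z) = 0" if "dist a z \<ge> 2 * r" for z
  proof -
    have "(2 * r)\<^sup>2 \<le> N z" unfolding N using that assms by (intro power_mono) auto
    then show ?thesis by (simp add: P_def flat_exp_def power_mult_distrib)
  qed
qed

text \<open>
  Differentiating under the integral sign multiplies the weight by \<open>t\<close>, so the class of these
  integrals is closed under differentiation.
\<close>

lemma has_derivative_segment_integral:
  fixes f :: "'e::euclidean_space \<Rightarrow> real"
  assumes "open S" "convex S" "a \<in> S" "smooth_on S f" "x \<in> S"
  shows "((\<lambda>x. integral (cbox 0 1) (\<lambda>t. t ^ m * f (a + t *\<^sub>R (x - a)))) has_derivative
    (\<lambda>v. integral (cbox 0 1) (\<lambda>t. t ^ Suc m * frechet_derivative f (at (a + t *\<^sub>R (x - a))) v))) (at x)"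
proof -
  let ?\<gamma> = "\<lambda>x t. a + t *\<^sub>R (x - a)"
  have seg: "?\<gamma> x t \<in> S" if "x \<in> S" "t \<in> cbox 0 1" for x t
  proof -
    have "?\<gamma> x t = (1 - t) *\<^sub>R a + t *\<^sub>R x" by (simp add: algebra_simps)
    then show ?thesis using that assms(2,3) by (auto simp: convex_alt)
  qed
  note df = smooth_on_has_derivative[OF assms(4)]
  \<comment> \<open>\<open>leibniz_rule\<close> wants the derivative as a jointly continuous map
    into bounded linear functions; in finite dimension continuity can be tested on basis vectors.
    The extra factor \<open>t\<close> is the inner derivative of
    \<open>a + t *\<^sub>R (x - a)\<close> in \<open>x\<close>.\<close>
  define D where "D x t = Blinfun (\<lambda>v. t ^ Suc m * frechet_derivative f (at (?\<gamma> x t)) v)" for x t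
  have D: "blinfun_apply (D x t) = (\<lambda>v. t ^ Suc m * frechet_derivative f (at (?\<gamma> x t)) v)"
    if "x \<in> S" "t \<in> cbox 0 1" for x t
    unfolding D_def
    by (intro bounded_linear_Blinfun_apply bounded_linear_const_mult
        has_derivative_bounded_linear[OF df[OF seg[OF that]]])
  have cS: "continuous_on (S \<times> cbox 0 1) (\<lambda>z. t (snd z) * h (?\<gamma> (fst z) (snd z)))"
    if "smooth_on S h" "continuous_on (cbox 0 1) t" for h :: "'e \<Rightarrow> real" and t
  proof -
    have "continuous_on (S \<times> cbox 0 1) (\<lambda>z. h (?\<gamma> (fst z) (snd z)))"
      using seg by (intro continuous_on_compose2[OF smooth_on_imp_continuous_on[OF that(1)]])
        (auto intro!: continuous_intros)
    moreover have "continuous_on (S \<times> cbox 0 1) (\<lambda>z. t (snd z))"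
      by (intro continuous_on_compose2[OF that(2)]) (auto intro!: continuous_intros)
    ultimately show ?thesis by (rule continuous_on_mult[rotated])
  qed
  have cD: "continuous_on (S \<times> cbox 0 1) (\<lambda>(x, t). D x t)"
  proof (rule continuous_on_blinfun_componentwise)
    fix i :: 'e
    have "continuous_on (S \<times> cbox 0 1)
        (\<lambda>z. snd z ^ Suc m * frechet_derivative f (at (?\<gamma> (fst z) (snd z))) i)"
      by (intro cS smooth_on_frechet_derivative assms(4) continuous_intros)
    then show "continuous_on (S \<times> cbox 0 1) (\<lambda>z. blinfun_apply (case z of (x, t) \<Rightarrow> D x t) i)"
      by (rule continuous_on_eq) (auto simp: D)
  qed
  have L: "((\<lambda>x. integral (cbox 0 1) (\<lambda>t. t ^ m * f (?\<gamma> x t))) has_derivative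
      blinfun_apply (integral (cbox 0 1) (D x))) (at x within S)"
  proof (rule leibniz_rule[OF _ _ cD assms(5,2)])
    fix x t assume xt: "x \<in> S" "t \<in> cbox (0::real) 1"
    have "((\<lambda>x. f (?\<gamma> x t)) has_derivative (\<lambda>v. frechet_derivative f (at (?\<gamma> x t)) (t *\<^sub>R v))) (at x within S)"
      by (rule has_derivative_compose[where f="\<lambda>x. ?\<gamma> x t", OF _ df[OF seg[OF xt]]]) (auto intro!: derivative_eq_intros)
    then have "((\<lambda>x. t ^ m * f (?\<gamma> x t)) has_derivative
        (\<lambda>v. t ^ m * frechet_derivative f (at (?\<gamma> x t)) (t *\<^sub>R v))) (at x within S)"
      by (rule has_derivative_mult_right)
    then show "((\<lambda>x. t ^ m * f (?\<gamma> x t)) has_derivative blinfun_apply (D x t)) (at x within S)"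
      using linear_cmul[OF has_derivative_linear[OF df[OF seg[OF xt]]], of t]
      by (simp add: D[OF xt] mult_ac)
  next
    fix x assume x: "x \<in> S"
    have "continuous_on (cbox 0 1) (\<lambda>t. f (?\<gamma> x t))"
      using seg[OF x] by (intro continuous_on_compose2[OF smooth_on_imp_continuous_on[OF assms(4)]])
        (auto intro!: continuous_intros)
    then show "(\<lambda>t. t ^ m * f (?\<gamma> x t)) integrable_on cbox 0 1"
      by (intro integrable_continuous continuous_intros)
  qed
  have Dint: "D x integrable_on cbox 0 1"
  proof (rule integrable_continuous)
    have "continuous_on (cbox 0 1) (\<lambda>t. case (x, t) of (x, t) \<Rightarrow> D x t)"
      using assms(5) by (intro continuous_on_compose2[OF cD]) (auto intro!: continuous_intros)
    then show "continuous_on (cbox 0 1) (D x)" by simp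
  qed
  have E: "blinfun_apply (integral (cbox 0 1) (D x)) v =
      integral (cbox 0 1) (\<lambda>t. t ^ Suc m * frechet_derivative f (at (?\<gamma> x t)) v)" for v
    unfolding blinfun_apply_integral[OF Dint]
    by (intro integral_cong) (simp only: D[OF assms(5)])
  show ?thesis
    by (rule has_derivative_eq_rhs[OF L[unfolded at_within_open[OF assms(5,1)]]]) (rule ext, rule E)
qed

lemma smooth_on_segment_integral:
  fixes f :: "'e::euclidean_space \<Rightarrow> real"
  assumes "open S" "convex S" "a \<in> S" "smooth_on S f"
  shows "smooth_on S (\<lambda>x. integral (cbox 0 1) (\<lambda>t. t ^ m * f (a + t *\<^sub>R (x - a))))"
proof -
  have "Ck_on k S (\<lambda>x. integral (cbox 0 1) (\<lambda>t. t ^ m * f (a + t *\<^sub>R (x - a))))" for k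
    using assms(4)
  proof (induction k arbitrary: f m)
    case 0
    show ?case unfolding Ck_on.simps
      by (rule has_derivative_continuous_on,
          rule has_derivative_at_withinI[OF has_derivative_segment_integral[OF assms(1-3) 0]])
  next
    case (Suc k)
    show ?case
      by (rule Ck_on_SucI[OF assms(1) has_derivative_segment_integral[OF assms(1-3) Suc.prems]])
        (assumption, rule Suc.IH[OF smooth_on_frechet_derivative[OF Suc.prems]])
  qed
  then show ?thesis by (simp add: smooth_on_def)
qed

text \<open>The fundamental theorem of calculus on the segment from \<open>a\<close> to
  \<open>x\<close> expresses \<open>f x - f a\<close> as the integral of the derivative in direction
  \<open>x - a\<close>; splitting this direction in the basis pulls the coordinates out of the
  integral. At \<open>x = a\<close> the integrand is constant, which gives
  \<open>h b a\<close>.\<close>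

lemma hadamard:
  fixes f :: "'e::euclidean_space \<Rightarrow> real"
  assumes "open S" "convex S" "a \<in> S" "smooth_on S f"
  obtains h where "\<And>b. smooth_on S (h b)"
    "\<And>x. x \<in> S \<Longrightarrow> f x = f a + (\<Sum>b\<in>Basis. ((x - a) \<bullet> b) * h b x)"
    "\<And>b. h b a = frechet_derivative f (at a) b"
proof
  define h where "h b x = integral (cbox 0 1)
    (\<lambda>t. t ^ 0 * frechet_derivative f (at (a + t *\<^sub>R (x - a))) b)" for b x
  show "smooth_on S (h b)" for b
    unfolding h_def
    by (intro smooth_on_segment_integral assms smooth_on_frechet_derivative)
  show "h b a = frechet_derivative f (at a) b" for b
    by (simp add: h_def)
  fix x assume x: "x \<in> S"
  let ?\<gamma> = "\<lambda>t. a + t *\<^sub>R (x - a)"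
  have seg: "?\<gamma> t \<in> S" if "t \<in> {0..1}" for t
  proof -
    have "?\<gamma> t = (1 - t) *\<^sub>R a + t *\<^sub>R x" by (simp add: algebra_simps)
    then show ?thesis using that assms(2,3) x by (auto simp: convex_alt)
  qed
  have d: "((\<lambda>t. f (?\<gamma> t)) has_vector_derivative frechet_derivative f (at (?\<gamma> t)) (x - a)) (at t within {0..1})"
    if "t \<in> {0..1}" for t
  proof -
    note df = smooth_on_has_derivative[OF assms(4) seg[OF that]]
    have "((\<lambda>t. f (?\<gamma> t)) has_derivative (\<lambda>s. frechet_derivative f (at (?\<gamma> t)) (s *\<^sub>R (x - a)))) (at t within {0..1})"
      by (rule has_derivative_compose[where f="?\<gamma>", OF _ df]) (auto intro!: derivative_eq_intros)
    then show ?thesis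
      by (simp add: has_vector_derivative_def linear_cmul[OF has_derivative_linear[OF df]])
  qed
  have I1: "((\<lambda>t. frechet_derivative f (at (?\<gamma> t)) (x - a)) has_integral (f (?\<gamma> 1) - f (?\<gamma> 0))) {0..1}"
    by (rule fundamental_theorem_of_calculus) (auto intro: d)
  have I2: "((\<lambda>t. \<Sum>b\<in>Basis. ((x - a) \<bullet> b) * frechet_derivative f (at (?\<gamma> t)) b) has_integral
      (\<Sum>b\<in>Basis. ((x - a) \<bullet> b) * h b x)) {0..1}"
  proof (intro has_integral_sum has_integral_mult_right finite_Basis)
    fix b :: 'e
    have "continuous_on {0..1} (\<lambda>t. frechet_derivative f (at (?\<gamma> t)) b)"
      using seg by (intro continuous_on_compose2[OF smooth_on_imp_continuous_on[OF
            smooth_on_frechet_derivative[OF assms(4)]]]) (auto intro!: continuous_intros)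
    then show "((\<lambda>t. frechet_derivative f (at (?\<gamma> t)) b) has_integral h b x) {0..1}"
      by (auto simp: h_def intro!: integrable_integral integrable_continuous_real)
  qed
  have I3: "frechet_derivative f (at (?\<gamma> t)) (x - a) =
      (\<Sum>b\<in>Basis. ((x - a) \<bullet> b) * frechet_derivative f (at (?\<gamma> t)) b)" if "t \<in> {0..1}" for t
  proof -
    have "linear (frechet_derivative f (at (?\<gamma> t)))"
      using smooth_on_has_derivative[OF assms(4) seg[OF that]] by (rule has_derivative_linear)
    then have "frechet_derivative f (at (?\<gamma> t)) (\<Sum>b\<in>Basis. ((x - a) \<bullet> b) *\<^sub>R b) =
      (\<Sum>b\<in>Basis. ((x - a) \<bullet> b) * frechet_derivative f (at (?\<gamma> t)) b)"
      by (simp add: linear_sum linear_cmul del: euclidean_representation)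
    then show ?thesis by (simp only: euclidean_representation)
  qed
  have "f x - f a = (\<Sum>b\<in>Basis. ((x - a) \<bullet> b) * h b x)"
    using has_integral_unique[OF has_integral_eq[OF I3 I1] I2] by simp
  then show "f x = f a + (\<Sum>b\<in>Basis. ((x - a) \<bullet> b) * h b x)" by simp
qed


subsection \<open>Vector fields and 1-forms\<close>

lemma sum_fun_apply: "(\<Sum>i\<in>I. f i) x = (\<Sum>i\<in>I. f i x)"
  for f :: "'i \<Rightarrow> 'a \<Rightarrow> 'b::comm_monoid_add"
  by (induction I rule: infinite_finite_induct) auto

lemma scaleR_fun_apply [simp]: "(c *\<^sub>R f) x = c *\<^sub>R f x"
  by (simp add: scaleR_fun_def)

lemma fsmul_apply [simp]: "fsmul f X y = f * X y"
  by (simp add: fsmul_def)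

section \<open>Charts, cut-off functions and germs of smooth functions\<close>

locale manifold =
  fixes A :: "('m::{t2_space, second_countable_topology}, 'e::euclidean_space) chart set"
  assumes manifold: "smooth_manifold A"
begin

abbreviation "F \<equiv> smooth_functions A"
abbreviation "VF \<equiv> vector_fields A"

lemma chart_at: obtains U x where "(U, x) \<in> A" "p \<in> U"
  using manifold by (force simp: smooth_manifold_def)

context
  fixes U x
  assumes chart: "(U, x) \<in> A"
begin

lemma chart_homeomorphism: "\<exists>y. homeomorphism U (x ` U) x y"
  and chart_open: "open U" and chart_image_open: "open (x ` U)"
  using manifold chart by (auto simp: smooth_manifold_def)

lemma chart_inj: "inj_on x U"
  using chart_homeomorphism by (metis homeomorphism_apply1 inj_onI)

lemma chart_inv [simp]: "q \<in> U \<Longrightarrow> the_inv_into U x (x q) = q"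
  by (rule the_inv_into_f_f[OF chart_inj])

lemma chart_continuous: "continuous_on U x"
  using chart_homeomorphism by (auto simp: homeomorphism_def)

lemma chart_inv_continuous: "continuous_on (x ` U) (the_inv_into U x)"
proof -
  obtain y where y: "homeomorphism U (x ` U) x y" using chart_homeomorphism by blast
  show ?thesis
    by (rule continuous_on_eq[of _ y]) (use y in \<open>auto simp: homeomorphism_def\<close>)
qed

lemma chart_open_map: "open W \<Longrightarrow> open (x ` (U \<inter> W))"
proof -
  assume "open W"
  obtain y where y: "homeomorphism U (x ` U) x y" using chart_homeomorphism by blast
  have "openin (top_of_set (x ` U)) (x ` (U \<inter> W))"
    by (rule homeomorphism_imp_open_map[OF y]) (simp add: \<open>open W\<close> openin_open_Int)
  then show ?thesis using chart_image_open openin_open_trans by blast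
qed

lemma chart_preimage_open: "open B \<Longrightarrow> open {q \<in> U. x q \<in> B}"
  using continuous_open_preimage[OF chart_continuous chart_open]
  by (simp add: Int_def vimage_def)

lemma transition_smooth: "(V, y) \<in> A \<Longrightarrow> smooth_on (x ` (U \<inter> V)) (y \<circ> the_inv_into U x)"
  using manifold chart by (fastforce simp: smooth_manifold_def)

end

lemma smooth_functionsD: "f \<in> F \<Longrightarrow> (U, x) \<in> A \<Longrightarrow> smooth_on (x ` U) (f \<circ> the_inv_into U x)"
  by (auto simp: smooth_functions_def)

lemma smooth_functions_local:
  assumes "\<And>p. \<exists>h\<in>F. eventually (\<lambda>q. f q = h q) (nhds p)"
  shows "f \<in> F"
  unfolding smooth_functions_def
proof safe
  fix U x assume c: "(U, x) \<in> A"
  show "smooth_on (x ` U) (f \<circ> the_inv_into U x)"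
  proof (rule smooth_on_local)
    fix z assume "z \<in> x ` U"
    then obtain p where p: "p \<in> U" "z = x p" by blast
    obtain h W where h: "h \<in> F" "open W" "p \<in> W" "\<And>q. q \<in> W \<Longrightarrow> f q = h q"
      using assms[of p] by (auto simp: eventually_nhds)
    have o: "open (x ` (U \<inter> W))" by (rule chart_open_map[OF c h(2)])
    have "smooth_on (x ` (U \<inter> W)) (h \<circ> the_inv_into U x)"
      by (rule smooth_on_subset[OF smooth_functionsD[OF h(1) c]]) auto
    then have "smooth_on (x ` (U \<inter> W)) (f \<circ> the_inv_into U x)"
      by (rule smooth_on_cong[OF o, rotated]) (auto simp: chart_inv[OF c] h(4))
    then show "\<exists>T. open T \<and> z \<in> T \<and> smooth_on T (f \<circ> the_inv_into U x)"
      using o p h by blast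
  qed
qed

lemma smooth_const: "(\<lambda>_. c) \<in> F"
  by (auto simp: smooth_functions_def o_def intro!: smooth_on_const chart_image_open)

lemma smooth_zero: "0 \<in> F"
  using smooth_const[of 0] by (simp add: zero_fun_def)

lemma smooth_add: "f \<in> F \<Longrightarrow> h \<in> F \<Longrightarrow> f + h \<in> F"
  by (auto simp: smooth_functions_def o_def plus_fun_def dest!: bspec
      intro!: smooth_on_add chart_image_open)

lemma smooth_mult: "f \<in> F \<Longrightarrow> h \<in> F \<Longrightarrow> f * h \<in> F"
  by (auto simp: smooth_functions_def o_def times_fun_def dest!: bspec
      intro!: smooth_on_mult chart_image_open)

lemma scaleR_eq_const_mult: "c *\<^sub>R f = (\<lambda>_. c) * f" for f :: "'m \<Rightarrow> real"
  by (auto simp: fun_eq_iff)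

lemma smooth_scaleR: "f \<in> F \<Longrightarrow> c *\<^sub>R f \<in> F"
  unfolding scaleR_eq_const_mult by (intro smooth_mult smooth_const)

lemma smooth_uminus: "f \<in> F \<Longrightarrow> - f \<in> F"
  using smooth_scaleR[of f "-1"] by simp

lemma smooth_diff: "f \<in> F \<Longrightarrow> h \<in> F \<Longrightarrow> f - h \<in> F"
  using smooth_add[OF _ smooth_uminus, of f h] by simp

lemma smooth_sum: "(\<And>i. i \<in> I \<Longrightarrow> f i \<in> F) \<Longrightarrow> (\<Sum>i\<in>I. f i) \<in> F"
  by (induction I rule: infinite_finite_induct) (auto intro: smooth_add smooth_zero)

text \<open>Seen in another chart, a point either lies in the open set where the function is
  \<open>h\<close> composed with a transition map, or it avoids the preimage of \<open>K\<close>.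
  That preimage is compact, hence closed in a Hausdorff space, so in the second case the function
  vanishes on a whole neighbourhood.\<close>

lemma smooth_extend_by_zero:
  assumes c: "(U, x) \<in> A" and B: "open B" "B \<subseteq> x ` U" and h: "smooth_on B h"
    and K: "compact K" "K \<subseteq> B" "\<And>z. z \<in> B - K \<Longrightarrow> h z = 0"
  shows "(\<lambda>q. if q \<in> U \<and> x q \<in> B then h (x q) else 0) \<in> F" (is "?f \<in> F")
  unfolding smooth_functions_def
proof safe
  fix V y assume c': "(V, y) \<in> A"
  let ?i = "the_inv_into V y" and ?j = "the_inv_into U x"
  let ?W = "{q \<in> U. x q \<in> B}"
  have W: "open ?W" by (rule chart_preimage_open[OF c B(1)])
  have "compact (?j ` K)"
    using K B by (intro compact_continuous_image continuous_on_subset[OF chart_inv_continuous[OF c]]) auto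
  then have L: "closed (?j ` K)" by (rule compact_imp_closed)
  show "smooth_on (y ` V) (?f \<circ> ?i)"
  proof (rule smooth_on_local)
    fix z assume "z \<in> y ` V"
    then obtain p where p: "p \<in> V" "z = y p" by blast
    show "\<exists>T. open T \<and> z \<in> T \<and> smooth_on T (?f \<circ> ?i)"
    proof (cases "p \<in> ?W")
      case True
      let ?T = "y ` (V \<inter> ?W)"
      have o: "open ?T" by (rule chart_open_map[OF c' W])
      have t: "smooth_on ?T (x \<circ> ?i)"
        by (rule smooth_on_subset[OF transition_smooth[OF c' c]]) auto
      have "smooth_on ?T (\<lambda>z. h ((x \<circ> ?i) z))"
        by (rule smooth_on_compose[OF o B(1) _ h t]) (auto simp: chart_inv[OF c'])
      then have "smooth_on ?T (?f \<circ> ?i)"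
        by (rule smooth_on_cong[OF o, rotated]) (auto simp: chart_inv[OF c'])
      then show ?thesis using o p True by blast
    next
      case False
      let ?T = "y ` (V \<inter> - ?j ` K)"
      have o: "open ?T" by (rule chart_open_map[OF c']) (use L in auto)
      have "p \<notin> ?j ` K"
        using False K(2) B(2) by (fastforce simp: chart_inv[OF c])
      then have "z \<in> ?T" using p by auto
      moreover have "smooth_on ?T (?f \<circ> ?i)"
        by (rule smooth_on_cong[OF o _ smooth_on_const[OF o, of 0]])
          (use K(3) in \<open>auto simp: chart_inv[OF c'] image_iff chart_inv[OF c]; metis chart_inv[OF c]\<close>)
      ultimately show ?thesis using o by blast
    qed
  qed
qed

text \<open>A single \<open>\<beta>\<close> serves all \<open>h\<close>, so coordinates and partial
  derivatives can be cut off together and stay unchanged on the same neighbourhood of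
  \<open>p\<close>.\<close>

lemma chart_cutoff:
  assumes c: "(U, x) \<in> A" and p: "p \<in> U" and B: "open B" "B \<subseteq> x ` U" "x p \<in> B"
  obtains \<beta> :: "'e \<Rightarrow> real" where
    "\<And>h. smooth_on B h \<Longrightarrow> (\<lambda>q. if q \<in> U \<and> x q \<in> B then \<beta> (x q) * h (x q) else 0) \<in> F"
    "eventually (\<lambda>q. q \<in> U \<and> x q \<in> B \<and> \<beta> (x q) = 1) (nhds p)"
proof -
  obtain e where e: "e > 0" "cball (x p) e \<subseteq> B"
    using B open_contains_cball by blast
  \<comment> \<open>With plateau radius \<open>e / 2\<close> the bump vanishes from radius
    \<open>e\<close> on, so the closed ball of radius \<open>e\<close> can serve as the compact set
    \<open>K\<close>.\<close>
  obtain \<beta> :: "'e \<Rightarrow> real" where \<beta>: "smooth_on UNIV \<beta>"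
    "\<And>z. dist (x p) z \<le> e / 2 \<Longrightarrow> \<beta> z = 1" "\<And>z. dist (x p) z \<ge> 2 * (e / 2) \<Longrightarrow> \<beta> z = 0"
    using smooth_bump_exists[of "e / 2" "x p"] e by auto
  show thesis
  proof
    fix h :: "'e \<Rightarrow> real" assume "smooth_on B h"
    then have "smooth_on B (\<lambda>z. \<beta> z * h z)"
      by (intro smooth_on_mult B smooth_on_subset[OF \<beta>(1)]) auto
    then show "(\<lambda>q. if q \<in> U \<and> x q \<in> B then \<beta> (x q) * h (x q) else 0) \<in> F"
      by (rule smooth_extend_by_zero[OF c B(1,2) _ compact_cball e(2)]) (auto simp: \<beta>(3))
  next
    let ?W = "{q \<in> U. x q \<in> ball (x p) (e / 2)}"
    have "open ?W" "p \<in> ?W"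
      using chart_preimage_open[OF c, of "ball (x p) (e / 2)"] p e by auto
    moreover have "q \<in> U \<and> x q \<in> B \<and> \<beta> (x q) = 1" if "q \<in> ?W" for q
      using that \<beta>(2)[of "x q"] e by (auto intro!: subsetD[OF e(2)])
    ultimately show "eventually (\<lambda>q. q \<in> U \<and> x q \<in> B \<and> \<beta> (x q) = 1) (nhds p)"
      unfolding eventually_nhds by blast
  qed
qed

text \<open>Multiplication by \<open>\<rho>\<close> turns an identity valid near \<open>p\<close>
  into a global one, the only kind to which derivations and function-linear maps apply.\<close>

lemma bump_exists:
  assumes "eventually P (nhds p)"
  obtains \<rho> where "\<rho> \<in> F" "eventually (\<lambda>q. \<rho> q = 1) (nhds p)" "\<And>q. \<rho> q \<noteq> 0 \<Longrightarrow> P q"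
proof -
  obtain W where W: "open W" "p \<in> W" "\<And>q. q \<in> W \<Longrightarrow> P q"
    using assms by (auto simp: eventually_nhds)
  obtain U x where c: "(U, x) \<in> A" and p: "p \<in> U" by (rule chart_at)
  let ?B = "x ` (U \<inter> W)"
  have B: "open ?B" by (rule chart_open_map[OF c W(1)])
  obtain \<beta> :: "'e \<Rightarrow> real" where \<beta>:
    "\<And>h. smooth_on ?B h \<Longrightarrow> (\<lambda>q. if q \<in> U \<and> x q \<in> ?B then \<beta> (x q) * h (x q) else 0) \<in> F"
    "eventually (\<lambda>q. q \<in> U \<and> x q \<in> ?B \<and> \<beta> (x q) = 1) (nhds p)"
    by (rule chart_cutoff[OF c p B]) (use p W in auto)
  let ?\<rho> = "\<lambda>q. if q \<in> U \<and> x q \<in> ?B then \<beta> (x q) * 1 else 0"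
  show thesis
  proof
    show "?\<rho> \<in> F" by (rule \<beta>(1)[OF smooth_on_const[OF B]])
    show "eventually (\<lambda>q. ?\<rho> q = 1) (nhds p)"
      using \<beta>(2) by eventually_elim auto
    fix q assume "?\<rho> q \<noteq> 0"
    then have "q \<in> U" "x q \<in> ?B" by (auto split: if_splits)
    then have "q \<in> W" by (metis IntD1 IntD2 chart_inv[OF c] imageE)
    then show "P q" by (rule W(3))
  qed
qed

lemma smooth_local_inverse:
  assumes d: "d \<in> F" "d p \<noteq> 0"
  obtains h where "h \<in> F" "eventually (\<lambda>q. d q * h q = 1) (nhds p)"
proof -
  obtain U x where c: "(U, x) \<in> A" and p: "p \<in> U" by (rule chart_at)
  let ?d = "d \<circ> the_inv_into U x"
  let ?B = "x ` U \<inter> ?d -` (- {0})"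
  have B: "open ?B"
    by (intro continuous_open_preimage smooth_on_imp_continuous_on smooth_functionsD d c
        chart_image_open[OF c]) auto
  obtain \<beta> :: "'e \<Rightarrow> real" where \<beta>:
    "\<And>h. smooth_on ?B h \<Longrightarrow> (\<lambda>q. if q \<in> U \<and> x q \<in> ?B then \<beta> (x q) * h (x q) else 0) \<in> F"
    "eventually (\<lambda>q. q \<in> U \<and> x q \<in> ?B \<and> \<beta> (x q) = 1) (nhds p)"
    by (rule chart_cutoff[OF c p B]) (use p d in \<open>auto simp: chart_inv[OF c]\<close>)
  let ?h = "\<lambda>q. if q \<in> U \<and> x q \<in> ?B then \<beta> (x q) * inverse (?d (x q)) else 0"
  show thesis
  proof
    show "?h \<in> F"
      by (intro \<beta>(1) smooth_on_inverse B smooth_on_subset[OF smooth_functionsD[OF d(1) c]]) auto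
    show "eventually (\<lambda>q. d q * ?h q = 1) (nhds p)"
      using \<beta>(2) by eventually_elim (auto simp: chart_inv[OF c] dest: inj_onD[OF chart_inj[OF c]])
  qed
qed

text \<open>Gaussian elimination over the ring of germs of smooth functions at \<open>p\<close>.\<close>

lemma smooth_local_linear_solve:
  assumes "finite I" "finite C" "card I = card C"
    and "\<And>b c. b \<in> I \<Longrightarrow> c \<in> C \<Longrightarrow> G b c \<in> F" "\<And>c. c \<in> C \<Longrightarrow> r c \<in> F"
    and "\<And>a. (\<And>c. c \<in> C \<Longrightarrow> (\<Sum>b\<in>I. a b * G b c p) = 0) \<Longrightarrow> (\<And>b. b \<in> I \<Longrightarrow> a b = (0::real))"
  shows "\<exists>a. (\<forall>b\<in>I. a b \<in> F) \<and>
    eventually (\<lambda>q. \<forall>c\<in>C. (\<Sum>b\<in>I. a b q * G b c q) = r c q) (nhds p)"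
  using assms
proof (induction I arbitrary: C G r rule: finite_induct)
  case empty
  then show ?case by simp
next
  case (insert k I)
  note nons = insert.prems(5)
  have sum_k: "(\<Sum>b\<in>insert k I. w b) = w k + (\<Sum>b\<in>I. w b)" for w :: "_ \<Rightarrow> real"
    using insert.hyps by simp
  \<comment> \<open>A pivot exists: if row \<open>k\<close> vanished at \<open>p\<close>, the unit
    vector at \<open>k\<close> would contradict the trivial kernel.\<close>
  have "\<exists>c\<in>C. G k c p \<noteq> 0"
  proof (rule ccontr)
    assume "\<not> ?thesis"
    then have "(if k = k then 1 else 0) = (0::real)"
      using insert.hyps
      by (intro nons[of "\<lambda>b. if b = k then 1 else 0"]) (auto simp: sum_k intro!: sum.neutral)
    then show False by simp
  qed
  then obtain c0 where c0: "c0 \<in> C" "G k c0 p \<noteq> 0" by blast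
  have GF: "G b c \<in> F" if "b \<in> insert k I" "c \<in> C" for b c using insert.prems(3) that by blast
  obtain h where h: "h \<in> F" "eventually (\<lambda>q. G k c0 q * h q = 1) (nhds p)"
    using smooth_local_inverse[of "G k c0" p] c0 GF by blast
  have hp: "G k c0 p * h p = 1" using h(2) by (rule eventually_nhds_x_imp_x)
  \<comment> \<open>Equation \<open>c0\<close> is solved for unknown \<open>k\<close>, with
    \<open>h\<close> as local reciprocal of the pivot, and substituted into the others;
    \<open>G'\<close> is the Schur complement of the pivot.\<close>
  define G' where "G' b c = G b c - G b c0 * h * G k c" for b c
  define r' where "r' c = r c - r c0 * h * G k c" for c
  have "\<exists>a. (\<forall>b\<in>I. a b \<in> F) \<and>
    eventually (\<lambda>q. \<forall>c\<in>C - {c0}. (\<Sum>b\<in>I. a b q * G' b c q) = r' c q) (nhds p)"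
  proof (rule insert.IH)
    show "card I = card (C - {c0})"
      using insert.prems(1,2) insert.hyps c0 by simp
    show "G' b c \<in> F" if "b \<in> I" "c \<in> C - {c0}" for b c
      unfolding G'_def using that c0 h by (intro smooth_diff smooth_mult GF) auto
    show "r' c \<in> F" if "c \<in> C - {c0}" for c
      unfolding r'_def using that c0 h insert.prems(4) by (intro smooth_diff smooth_mult GF) auto
    fix a b assume a: "\<And>c. c \<in> C - {c0} \<Longrightarrow> (\<Sum>b\<in>I. a b * G' b c p) = 0" and b: "b \<in> I"
    define s where "s = (\<Sum>b\<in>I. a b * G b c0 p)"
    have "(\<Sum>b\<in>I. a b * G' b c p) = (\<Sum>b\<in>I. a b * G b c p) - s * h p * G k c p" for c
      by (simp add: G'_def s_def right_diff_distrib sum_subtractf sum_distrib_left mult_ac)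
    then have e: "(\<Sum>b\<in>I. a b * G b c p) = s * h p * G k c p" if "c \<in> C" for c
      using a[of c] that hp by (cases "c = c0") (auto simp: s_def[symmetric] mult_ac)
    \<comment> \<open>A kernel vector of the reduced matrix extends to one of the full matrix, its
      entry at \<open>k\<close> being dictated by equation \<open>c0\<close>.\<close>
    have "(a(k := - s * h p)) b = 0"
    proof (rule nons)
      fix c assume "c \<in> C"
      have "(\<Sum>b\<in>I. (a(k := - s * h p)) b * G b c p) = (\<Sum>b\<in>I. a b * G b c p)"
        using insert.hyps by (intro sum.cong) auto
      then show "(\<Sum>b\<in>insert k I. (a(k := - s * h p)) b * G b c p) = 0"
        using e[OF \<open>c \<in> C\<close>] by (simp add: sum_k)
    qed (use b in auto)
    then show "a b = 0" using b insert.hyps by (auto split: if_splits)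
  qed (use insert.prems in auto)
  then obtain a where a: "\<And>b. b \<in> I \<Longrightarrow> a b \<in> F"
    "eventually (\<lambda>q. \<forall>c\<in>C - {c0}. (\<Sum>b\<in>I. a b q * G' b c q) = r' c q) (nhds p)" by blast
  define a' where "a' = a(k := h * (r c0 - (\<Sum>b\<in>I. a b * G b c0)))"
  have a'F: "a' b \<in> F" if "b \<in> insert k I" for b
    using that a(1) h(1) c0 insert.prems(4) GF unfolding a'_def
    by (cases "b = k") (auto intro!: smooth_diff smooth_mult smooth_sum)
  have "eventually (\<lambda>q. \<forall>c\<in>C. (\<Sum>b\<in>insert k I. a' b q * G b c q) = r c q) (nhds p)"
    using a(2) h(2)
  proof eventually_elim
    case (elim q)
    define s where "s = (\<Sum>b\<in>I. a b q * G b c0 q)"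
    show ?case
    proof
      fix c assume c: "c \<in> C"
      have "(\<Sum>b\<in>I. a b q * G' b c q) = (\<Sum>b\<in>I. a b q * G b c q) - s * h q * G k c q"
        by (simp add: G'_def s_def right_diff_distrib sum_subtractf sum_distrib_left mult_ac)
      then have e: "(\<Sum>b\<in>I. a b q * G b c q) = s * h q * G k c q + r c q - r c0 q * h q * G k c q"
        using elim c by (cases "c = c0") (auto simp: s_def[symmetric] r'_def mult_ac)
      have "(\<Sum>b\<in>I. a' b q * G b c q) = (\<Sum>b\<in>I. a b q * G b c q)"
        using insert.hyps by (intro sum.cong) (auto simp: a'_def)
      then have "(\<Sum>b\<in>insert k I. a' b q * G b c q) =
          h q * (r c0 q - s) * G k c q + (\<Sum>b\<in>I. a b q * G b c q)"
        by (simp add: sum_k a'_def s_def sum_fun_apply)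
      then show "(\<Sum>b\<in>insert k I. a' b q * G b c q) = r c q"
        unfolding e by (simp add: algebra_simps)
    qed
  qed
  then show ?case using a'F by blast
qed

section \<open>Derivations and coordinate frames\<close>

lemma VF_apply_smooth: "X \<in> VF \<Longrightarrow> f \<in> F \<Longrightarrow> X f \<in> F"
  and VF_apply_add: "X \<in> VF \<Longrightarrow> f \<in> F \<Longrightarrow> h \<in> F \<Longrightarrow> X (f + h) = X f + X h"
  and VF_apply_scaleR: "X \<in> VF \<Longrightarrow> f \<in> F \<Longrightarrow> X (c *\<^sub>R f) = c *\<^sub>R X f"
  and VF_apply_mult: "X \<in> VF \<Longrightarrow> f \<in> F \<Longrightarrow> h \<in> F \<Longrightarrow> X (f * h) = f * X h + h * X f"
  and VF_apply_undefined: "X \<in> VF \<Longrightarrow> f \<notin> F \<Longrightarrow> X f = 0"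
  by (auto simp: vector_fields_def)

lemma VF_apply_zero: "X \<in> VF \<Longrightarrow> X 0 = 0"
  using VF_apply_scaleR[of X 0 0] smooth_zero by simp

lemma VF_apply_const:
  assumes "X \<in> VF"
  shows "X (\<lambda>_. c) = 0"
proof -
  have "X (\<lambda>_. 1) = 0"
    using VF_apply_mult[OF assms smooth_const[of 1] smooth_const[of 1]]
    by (simp add: fun_eq_iff times_fun_def)
  then show ?thesis
    using VF_apply_scaleR[OF assms smooth_const[of 1], of c] by (simp add: scaleR_fun_def zero_fun_def)
qed

lemma VF_apply_sum:
  assumes "X \<in> VF" "\<And>i. i \<in> I \<Longrightarrow> f i \<in> F"
  shows "X (\<Sum>i\<in>I. f i) = (\<Sum>i\<in>I. X (f i))"
  using assms(2)
  by (induction I rule: infinite_finite_induct) (auto simp: VF_apply_zero VF_apply_add smooth_sum assms(1))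

text \<open>For a bump \<open>\<rho>\<close> supported where the functions agree,
  \<open>\<rho> * f = \<rho> * h\<close> globally. In the product rule at \<open>p\<close> the terms
  with \<open>X \<rho>\<close> coincide because \<open>f p = h p\<close>.\<close>

lemma VF_apply_local:
  assumes X: "X \<in> VF" and f: "f \<in> F" "h \<in> F" and e: "eventually (\<lambda>q. f q = h q) (nhds p)"
  shows "X f p = X h p"
proof -
  obtain \<rho> where \<rho>: "\<rho> \<in> F" "eventually (\<lambda>q. \<rho> q = 1) (nhds p)" "\<And>q. \<rho> q \<noteq> 0 \<Longrightarrow> f q = h q"
    using bump_exists[OF e] by blast
  have p: "\<rho> p = 1" "f p = h p" using \<rho>(2) e by (auto dest: eventually_nhds_x_imp_x)
  have "\<rho> * f = \<rho> * h" using \<rho>(3) by (auto simp: fun_eq_iff)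
  then have "X (\<rho> * f) p = X (\<rho> * h) p" by simp
  then show ?thesis using p by (simp add: VF_apply_mult X f \<rho>)
qed

lemma VF_add: "X \<in> VF \<Longrightarrow> Y \<in> VF \<Longrightarrow> X + Y \<in> VF"
  by (auto simp: vector_fields_def smooth_add algebra_simps scaleR_add_right fun_eq_iff)

lemma VF_fsmul: "f \<in> F \<Longrightarrow> X \<in> VF \<Longrightarrow> fsmul f X \<in> VF"
  by (auto simp: vector_fields_def smooth_mult algebra_simps fun_eq_iff)

lemma VF_zero: "0 \<in> VF"
  by (auto simp: vector_fields_def smooth_zero fun_eq_iff)

lemma VF_scaleR: "X \<in> VF \<Longrightarrow> c *\<^sub>R X \<in> VF"
proof -
  assume "X \<in> VF"
  then have "fsmul (\<lambda>_. c) X \<in> VF" by (rule VF_fsmul[OF smooth_const])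
  moreover have "fsmul (\<lambda>_. c) X = c *\<^sub>R X" by (simp add: fun_eq_iff)
  ultimately show ?thesis by simp
qed

lemma VF_uminus: "X \<in> VF \<Longrightarrow> - X \<in> VF"
  using VF_scaleR[of X "-1"] by simp

lemma VF_diff: "X \<in> VF \<Longrightarrow> Y \<in> VF \<Longrightarrow> X - Y \<in> VF"
  using VF_add[OF _ VF_uminus, of X Y] by simp

lemma VF_sum: "(\<And>i. i \<in> I \<Longrightarrow> X i \<in> VF) \<Longrightarrow> (\<Sum>i\<in>I. X i) \<in> VF"
  by (induction I rule: infinite_finite_induct) (auto intro: VF_add VF_zero)

text \<open>Hadamard's lemma at \<open>x q\<close>, cut off to the whole manifold, writes
  \<open>f\<close> near \<open>q\<close> as a constant plus products in which one factor vanishes at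
  \<open>q\<close>. Under \<open>X\<close> only the derivative of that factor survives at
  \<open>q\<close>.\<close>

lemma VF_chart_expansion:
  assumes c: "(U, x) \<in> A" and q: "q \<in> U" and X: "X \<in> VF" and f: "f \<in> F"
    and xs: "\<And>b. xs b \<in> F" "\<And>b. eventually (\<lambda>q'. xs b q' = x q' \<bullet> b) (nhds q)"
  shows "X f q = (\<Sum>b\<in>Basis. X (xs b) q * frechet_derivative (f \<circ> the_inv_into U x) (at (x q)) b)"
proof -
  let ?f = "f \<circ> the_inv_into U x"
  obtain e where e: "e > 0" "ball (x q) e \<subseteq> x ` U"
    using chart_image_open[OF c] q by (metis imageI openE)
  let ?B = "ball (x q) e"
  have qB: "x q \<in> ?B" using e by simp
  have sB: "smooth_on ?B ?f" by (rule smooth_on_subset[OF smooth_functionsD[OF f c] e(2)])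
  obtain h where h: "\<And>b. smooth_on ?B (h b)"
    "\<And>z. z \<in> ?B \<Longrightarrow> ?f z = ?f (x q) + (\<Sum>b\<in>Basis. ((z - x q) \<bullet> b) * h b z)"
    "\<And>b. h b (x q) = frechet_derivative ?f (at (x q)) b"
    using hadamard[OF open_ball convex_ball qB sB] by blast
  obtain \<beta> :: "'e \<Rightarrow> real" where \<beta>:
    "\<And>h. smooth_on ?B h \<Longrightarrow> (\<lambda>q. if q \<in> U \<and> x q \<in> ?B then \<beta> (x q) * h (x q) else 0) \<in> F"
    "eventually (\<lambda>q. q \<in> U \<and> x q \<in> ?B \<and> \<beta> (x q) = 1) (nhds q)"
    using chart_cutoff[OF c q open_ball e(2) qB] by blast
  define H where "H b q' = (if q' \<in> U \<and> x q' \<in> ?B then \<beta> (x q') * h b (x q') else 0)" for b q'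
  have HF: "H b \<in> F" for b unfolding H_def by (rule \<beta>(1)[OF h(1)])
  have Hq: "H b q = frechet_derivative ?f (at (x q)) b" for b
    using eventually_nhds_x_imp_x[OF \<beta>(2)] by (simp add: H_def h(3))
  \<comment> \<open>The coordinates are shifted by constants so as to vanish at \<open>q\<close>;
    \<open>X\<close> does not see the shift.\<close>
  define y where "y b = xs b + (\<lambda>_. - (x q \<bullet> b))" for b
  have yF: "y b \<in> F" for b unfolding y_def by (intro smooth_add xs smooth_const)
  have yq: "y b q = 0" for b
    using eventually_nhds_x_imp_x[OF xs(2)] by (simp add: y_def)
  have Xy: "X (y b) = X (xs b)" for b
    unfolding y_def by (simp add: VF_apply_add[OF X xs(1) smooth_const] VF_apply_const[OF X])
  define f' where "f' = (\<lambda>_. f q) + (\<Sum>b\<in>Basis. y b * H b)"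
  have "eventually (\<lambda>q'. \<forall>b\<in>Basis. xs b q' = x q' \<bullet> b) (nhds q)"
    by (rule eventually_ball_finite) (auto intro: xs(2))
  then have "eventually (\<lambda>q'. f q' = f' q') (nhds q)"
    using \<beta>(2)
  proof eventually_elim
    case (elim q')
    then have "f q' = f q + (\<Sum>b\<in>Basis. ((x q' - x q) \<bullet> b) * h b (x q'))"
      using h(2)[of "x q'"] q by (simp add: chart_inv[OF c])
    then show ?case
      using elim by (simp add: f'_def sum_fun_apply y_def H_def inner_diff_left)
  qed
  moreover have "f' \<in> F"
    unfolding f'_def by (intro smooth_add smooth_const smooth_sum smooth_mult yF HF)
  ultimately have "X f q = X f' q" using VF_apply_local[OF X f] by blast
  also have "X f' = (\<Sum>b\<in>Basis. y b * X (H b) + H b * X (y b))"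
    unfolding f'_def
    by (simp add: VF_apply_add[OF X smooth_const] VF_apply_const[OF X] VF_apply_sum[OF X] VF_apply_mult[OF X] smooth_sum smooth_mult yF HF)
  finally show ?thesis
    by (simp add: sum_fun_apply yq Hq Xy mult.commute)
qed

text \<open>\<open>E b\<close> is the partial derivative in direction \<open>b\<close>, multiplied
  by a cut-off that makes it a global derivation. One neighbourhood \<open>W\<close> of
  \<open>p\<close> carries both the true coordinates and the true partial derivatives, so the
  relations hold at all points near \<open>p\<close> and for all fields at once.\<close>

lemma local_frame:
  obtains xs :: "'e \<Rightarrow> 'm \<Rightarrow> real" and E :: "'e \<Rightarrow> 'm vector_field" where
    "\<And>b. xs b \<in> F" "\<And>b. E b \<in> VF"
    "eventually (\<lambda>q. \<forall>b\<in>Basis. \<forall>c\<in>Basis. E b (xs c) q = (if b = c then 1 else 0)) (nhds p)"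
    "eventually (\<lambda>q. \<forall>X\<in>VF. \<forall>f\<in>F. X f q = (\<Sum>b\<in>Basis. X (xs b) q * E b f q)) (nhds p)"
proof -
  obtain U x where c: "(U, x) \<in> A" and p: "p \<in> U" by (rule chart_at)
  let ?i = "the_inv_into U x"
  have oU: "open (x ` U)" by (rule chart_image_open[OF c])
  obtain \<beta> :: "'e \<Rightarrow> real" where \<beta>:
    "\<And>h. smooth_on (x ` U) h \<Longrightarrow> (\<lambda>q. if q \<in> U \<and> x q \<in> x ` U then \<beta> (x q) * h (x q) else 0) \<in> F"
    "eventually (\<lambda>q. q \<in> U \<and> x q \<in> x ` U \<and> \<beta> (x q) = 1) (nhds p)"
    by (rule chart_cutoff[OF c p oU]) (use p in auto)
  have \<beta>1: "(\<lambda>q. if q \<in> U then \<beta> (x q) * h (x q) else 0) \<in> F" if "smooth_on (x ` U) h" for h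
    using \<beta>(1)[OF that] by (simp cong: conj_cong)
  obtain W where W: "open W" "p \<in> W" "\<And>q. q \<in> W \<Longrightarrow> q \<in> U \<and> \<beta> (x q) = 1"
    using \<beta>(2) by (auto simp: eventually_nhds)
  define xs where "xs b q = (if q \<in> U then \<beta> (x q) * (x q \<bullet> b) else 0)" for b q
  define D where "D f z b = frechet_derivative (f \<circ> ?i) (at z) b" for f :: "'m \<Rightarrow> real" and z b
  define E where "E b f = (if f \<in> F then (\<lambda>q. if q \<in> U then \<beta> (x q) * D f (x q) b else 0) else 0)" for b f
  have dD: "((f \<circ> ?i) has_derivative D f z) (at z)" if "f \<in> F" "z \<in> x ` U" for f z
    unfolding D_def by (rule smooth_on_has_derivative[OF smooth_functionsD[OF that(1) c] that(2)])
  have D_eqI: "D f z = D'" if "((f \<circ> ?i) has_derivative D') (at z)" for f z D'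
    using frechet_derivative_at[OF that] by (simp add: D_def fun_eq_iff)
  show thesis
  proof
    show xsF: "xs b \<in> F" for b
      unfolding xs_def
      by (intro \<beta>1 smooth_on_bounded_linear[OF oU bounded_linear_inner_left])
    show EV: "E b \<in> VF" for b
      unfolding vector_fields_def
    proof (intro CollectI conjI ballI allI impI)
      fix f assume f: "f \<in> F"
      show "E b f \<in> F"
        using f unfolding E_def D_def
        by (auto intro!: \<beta>1 smooth_on_frechet_derivative smooth_functionsD c)
      show "E b (c *\<^sub>R f) = c *\<^sub>R E b f" for c
      proof -
        have "D (c *\<^sub>R f) z = (\<lambda>v. c *\<^sub>R D f z v)" if "z \<in> x ` U" for z
          by (rule D_eqI) (use has_derivative_scaleR_right[OF dD[OF f that], of c] in
              \<open>simp add: o_def scaleR_fun_def\<close>)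
        then show ?thesis using f by (auto simp: E_def smooth_scaleR fun_eq_iff)
      qed
      fix h assume h: "h \<in> F"
      show "E b (f + h) = E b f + E b h"
      proof -
        have "D (f + h) z = (\<lambda>v. D f z v + D h z v)" if "z \<in> x ` U" for z
          by (rule D_eqI) (use has_derivative_add[OF dD[OF f that] dD[OF h that]] in
              \<open>simp add: o_def plus_fun_def\<close>)
        then show ?thesis using f h by (auto simp: E_def smooth_add fun_eq_iff algebra_simps)
      qed
      show "E b (f * h) = f * E b h + h * E b f"
      proof -
        have "D (f * h) z = (\<lambda>v. f (?i z) * D h z v + D f z v * h (?i z))" if "z \<in> x ` U" for z
          by (rule D_eqI) (use has_derivative_mult[OF dD[OF f that] dD[OF h that]] in
              \<open>simp add: o_def times_fun_def\<close>)
        then show ?thesis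
          using f h by (auto simp: E_def smooth_mult fun_eq_iff algebra_simps chart_inv[OF c])
      qed
    next
      fix f assume "f \<notin> F"
      then show "E b f = 0" by (simp add: E_def)
    qed
    have EW: "E b f q = D f (x q) b" if "q \<in> W" "f \<in> F" for b f q
      using that W(3) by (simp add: E_def)
    have xsW: "eventually (\<lambda>q'. xs b q' = x q' \<bullet> b) (nhds q)" if "q \<in> W" for b q
      using eventually_nhds_in_open[OF W(1) that] by eventually_elim (simp add: xs_def W(3))
    have "\<forall>b\<in>Basis. \<forall>c\<in>Basis. E b (xs c) q = (if b = c then 1 else 0)" if "q \<in> W" for q
    proof (intro ballI)
      fix b k :: 'e assume bk: "b \<in> Basis" "k \<in> Basis"
      have "((\<lambda>z. z \<bullet> k) has_derivative (\<lambda>v. v \<bullet> k)) (at (x q))"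
        by (intro bounded_linear_imp_has_derivative bounded_linear_inner_left)
      then have "((xs k \<circ> ?i) has_derivative (\<lambda>v. v \<bullet> k)) (at (x q))"
        by (rule has_derivative_transform_within_open[OF _ chart_open_map[OF c W(1)]])
          (use that W(3) in \<open>auto simp: xs_def chart_inv[OF c]\<close>)
      then show "E b (xs k) q = (if b = k then 1 else 0)"
        using bk that by (simp add: EW xsF D_eqI inner_Basis)
    qed
    then show "eventually (\<lambda>q. \<forall>b\<in>Basis. \<forall>c\<in>Basis. E b (xs c) q = (if b = c then 1 else 0)) (nhds p)"
      using W(1,2) unfolding eventually_nhds by blast
    have "\<forall>X\<in>VF. \<forall>f\<in>F. X f q = (\<Sum>b\<in>Basis. X (xs b) q * E b f q)" if "q \<in> W" for q
      using VF_chart_expansion[OF c _ _ _ xsF xsW[OF that]] W(3)[OF that]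
      by (simp add: EW[OF that] D_def)
    then show "eventually (\<lambda>q. \<forall>X\<in>VF. \<forall>f\<in>F. X f q = (\<Sum>b\<in>Basis. X (xs b) q * E b f q)) (nhds p)"
      using W(1,2) unfolding eventually_nhds by blast
  qed
qed

text \<open>Positive dimension enters here, through \<open>nonempty_Basis\<close>: a frame field is
  nonzero because it differentiates its own coordinate to \<open>1\<close>.\<close>

lemma ex_nonvanishing_vector_field: "\<exists>X\<in>VF. value_at p X \<noteq> 0"
proof -
  obtain xs :: "'e \<Rightarrow> 'm \<Rightarrow> real" and E where f: "\<And>b. E b \<in> VF"
    "eventually (\<lambda>q. \<forall>b\<in>Basis. \<forall>c\<in>Basis. E b (xs c) q = (if b = c then 1 else 0)) (nhds p)"
    by (rule local_frame) blast
  obtain b :: 'e where "b \<in> Basis" using nonempty_Basis by blast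
  then have "E b (xs b) p = 1" using eventually_nhds_x_imp_x[OF f(2)] by simp
  then have "value_at p (E b) \<noteq> 0"
    by (metis value_at_def zero_fun_apply zero_neq_one)
  then show ?thesis using f(1) by blast
qed

section \<open>Function-linear maps and the bijectivity of \<open>flat\<close>\<close>

definition tensorial :: "('m vector_field \<Rightarrow> 'm \<Rightarrow> real) \<Rightarrow> bool" where
  "tensorial T \<longleftrightarrow> (\<forall>X\<in>VF. \<forall>Y\<in>VF. T (X + Y) = T X + T Y) \<and>
     (\<forall>f\<in>F. \<forall>X\<in>VF. T (fsmul f X) = f * T X)"

lemma tensorial_add: "tensorial T \<Longrightarrow> X \<in> VF \<Longrightarrow> Y \<in> VF \<Longrightarrow> T (X + Y) = T X + T Y"
  and tensorial_fsmul: "tensorial T \<Longrightarrow> f \<in> F \<Longrightarrow> X \<in> VF \<Longrightarrow> T (fsmul f X) = f * T X"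
  by (auto simp: tensorial_def)

lemma tensorial_scaleR: "tensorial T \<Longrightarrow> X \<in> VF \<Longrightarrow> T (c *\<^sub>R X) = c *\<^sub>R T X"
proof -
  assume T: "tensorial T" "X \<in> VF"
  have "c *\<^sub>R X = fsmul (\<lambda>_. c) X" by (simp add: fun_eq_iff)
  then show ?thesis
    using tensorial_fsmul[OF T(1) smooth_const T(2), of c] by (simp add: scaleR_eq_const_mult)
qed

lemma tensorial_zero: "tensorial T \<Longrightarrow> T 0 = 0"
  using tensorial_scaleR[OF _ VF_zero, of T 0] by simp

lemma tensorial_diff: "tensorial T \<Longrightarrow> X \<in> VF \<Longrightarrow> Y \<in> VF \<Longrightarrow> T (X - Y) = T X - T Y"
  using tensorial_add[of T X "(-1) *\<^sub>R Y"] tensorial_scaleR[of T Y "-1"] VF_scaleR[of Y "-1"] by simp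

lemma tensorial_sum:
  assumes "tensorial T" "\<And>i. i \<in> I \<Longrightarrow> X i \<in> VF"
  shows "T (\<Sum>i\<in>I. X i) = (\<Sum>i\<in>I. T (X i))"
  using assms(2)
  by (induction I rule: infinite_finite_induct)
    (auto simp: tensorial_zero tensorial_add VF_sum assms(1))

text \<open>\<open>T\<close> accepts global fields only, so the local expansion of \<open>X\<close>
  is first multiplied by a bump \<open>\<rho>\<close> and becomes a global identity for
  \<open>fsmul \<rho> X\<close>. Function-linearity applies to it, and \<open>\<rho> q = 1\<close>.
  The notion \<open>tensorial\<close> covers 1-forms and each slot of a bilinear form alike.\<close>

lemma tensorial_frame_expansion:
  assumes T: "tensorial T" and X: "X \<in> VF" and fr: "\<And>b. xs b \<in> F" "\<And>b. E b \<in> VF"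
    "eventually (\<lambda>q. \<forall>X\<in>VF. \<forall>f\<in>F. X f q = (\<Sum>b\<in>Basis. X (xs b) q * E b f q)) (nhds q)"
  shows "T X q = (\<Sum>b\<in>Basis. X (xs b) q * T (E b) q)"
proof -
  obtain \<rho> where \<rho>: "\<rho> \<in> F" "eventually (\<lambda>q. \<rho> q = 1) (nhds q)"
    "\<And>q. \<rho> q \<noteq> 0 \<Longrightarrow> \<forall>X\<in>VF. \<forall>f\<in>F. X f q = (\<Sum>b\<in>Basis. X (xs b) q * E b f q)"
    using bump_exists[OF fr(3)] by blast
  have \<rho>q: "\<rho> q = 1" using \<rho>(2) by (rule eventually_nhds_x_imp_x)
  have "fsmul \<rho> X f q' = (\<Sum>b\<in>Basis. fsmul (\<rho> * X (xs b)) (E b)) f q'" for f q'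
  proof (cases "f \<in> F")
    case True
    show ?thesis
    proof (cases "\<rho> q' = 0")
      case False
      then have "X f q' = (\<Sum>b\<in>Basis. X (xs b) q' * E b f q')" using \<rho>(3) X True by blast
      then show ?thesis by (simp add: sum_fun_apply sum_distrib_left mult.assoc)
    qed (simp add: sum_fun_apply)
  next
    case False
    then show ?thesis by (simp add: sum_fun_apply VF_apply_undefined[OF X] VF_apply_undefined[OF fr(2)])
  qed
  then have "fsmul \<rho> X = (\<Sum>b\<in>Basis. fsmul (\<rho> * X (xs b)) (E b))" by blast
  then have "T (fsmul \<rho> X) = (\<Sum>b\<in>Basis. T (fsmul (\<rho> * X (xs b)) (E b)))"
    by (simp add: tensorial_sum[OF T] VF_fsmul smooth_mult \<rho>(1) VF_apply_smooth[OF X] fr)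
  then have "\<rho> * T X = (\<Sum>b\<in>Basis. (\<rho> * X (xs b)) * T (E b))"
    by (simp add: tensorial_fsmul[OF T] X smooth_mult \<rho>(1) VF_apply_smooth[OF X] fr)
  then have "(\<rho> * T X) q = (\<Sum>b\<in>Basis. (\<rho> * X (xs b)) * T (E b)) q" by simp
  then show ?thesis by (simp add: \<rho>q sum_fun_apply)
qed

lemma tensorial_pointwise:
  assumes T: "tensorial T" and X: "X \<in> VF" and q: "value_at q X = 0"
  shows "T X q = 0"
proof -
  obtain xs :: "'e \<Rightarrow> 'm \<Rightarrow> real" and E where f: "\<And>b. xs b \<in> F" "\<And>b. E b \<in> VF"
    "eventually (\<lambda>q. \<forall>X\<in>VF. \<forall>f\<in>F. X f q = (\<Sum>b\<in>Basis. X (xs b) q * E b f q)) (nhds q)"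
    by (rule local_frame) blast
  have "X y q = 0" for y using q by (metis value_at_def zero_fun_apply)
  then show ?thesis using tensorial_frame_expansion[OF T X f] by simp
qed

lemma one_form_tensorial: "\<xi> \<in> one_forms A \<Longrightarrow> tensorial \<xi>"
  by (auto simp: one_forms_def tensorial_def)

lemma bilinear_tensorial:
  assumes "F_bilinear F VF fsmul g" "Y \<in> VF"
  shows "tensorial (\<lambda>X. g X Y)" "tensorial (g Y)"
  using assms by (auto simp: F_bilinear_def tensorial_def)

text \<open>In a frame this is a linear system with Gram matrix \<open>g (E b) (E c)\<close>.
  Nondegeneracy makes the matrix invertible at \<open>p\<close>, and elimination over germs extends
  the solution to a neighbourhood.\<close>

lemma bilinear_represents_one_form_locally:
  assumes g: "F_bilinear F VF fsmul g" "nondegenerate VF value_at g" and \<xi>: "\<xi> \<in> one_forms A"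
  shows "\<exists>X\<in>VF. eventually (\<lambda>q. \<forall>Y\<in>VF. g X Y q = \<xi> Y q) (nhds p)"
proof -
  obtain xs :: "'e \<Rightarrow> 'm \<Rightarrow> real" and E where fr: "\<And>b. xs b \<in> F" "\<And>b. E b \<in> VF"
    "eventually (\<lambda>q. \<forall>b\<in>Basis. \<forall>c\<in>Basis. E b (xs c) q = (if b = c then 1 else 0)) (nhds p)"
    "eventually (\<lambda>q. \<forall>X\<in>VF. \<forall>f\<in>F. X f q = (\<Sum>b\<in>Basis. X (xs b) q * E b f q)) (nhds p)"
    by (rule local_frame) blast
  note tl = bilinear_tensorial(1)[OF g(1)] and tr = bilinear_tensorial(2)[OF g(1)]
  have "\<exists>a. (\<forall>b\<in>Basis. a b \<in> F) \<and>
    eventually (\<lambda>q. \<forall>c\<in>Basis. (\<Sum>b\<in>Basis. a b q * g (E b) (E c) q) = \<xi> (E c) q) (nhds p)"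
  proof (rule smooth_local_linear_solve)
    show "g (E b) (E c) \<in> F" for b c
      using g(1) fr(2) by (auto simp: F_bilinear_def)
    show "\<xi> (E c) \<in> F" for c
      using \<xi> fr(2) by (auto simp: one_forms_def)
    fix a and b :: 'e assume a: "\<And>c. c \<in> Basis \<Longrightarrow> (\<Sum>b\<in>Basis. a b * g (E b) (E c) p) = 0" and b: "b \<in> Basis"
    \<comment> \<open>A kernel vector of the Gram matrix gives a combination of the frame that is
      null at \<open>p\<close>, hence zero there; applying it to the coordinate \<open>xs b\<close>
      recovers \<open>a b\<close>.\<close>
    define Y where "Y = (\<Sum>b\<in>Basis. a b *\<^sub>R E b)"
    have Y: "Y \<in> VF" unfolding Y_def by (intro VF_sum VF_scaleR fr)
    have "g Y Z p = 0" if Z: "Z \<in> VF" for Z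
    proof -
      have "g Y (E c) p = (\<Sum>b\<in>Basis. a b * g (E b) (E c) p)" for c
        unfolding Y_def
        by (simp add: tensorial_sum[OF tl[OF fr(2)]] tensorial_scaleR[OF tl[OF fr(2)]] VF_scaleR fr(2) sum_fun_apply)
      then show ?thesis
        by (simp add: tensorial_frame_expansion[OF tr[OF Y] Z fr(1,2,4)] a)
    qed
    then have "value_at p Y = 0" using g(2) Y unfolding nondegenerate_def by blast
    then have "Y (xs b) p = 0" by (metis value_at_def zero_fun_apply)
    moreover have "Y (xs b) p = (\<Sum>k\<in>Basis. a k * E k (xs b) p)"
      by (simp add: Y_def sum_fun_apply)
    moreover have "\<dots> = (\<Sum>k\<in>Basis. if k = b then a k else 0)"
      using eventually_nhds_x_imp_x[OF fr(3)] b by (intro sum.cong) auto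
    ultimately show "a b = 0" using b by simp
  qed auto
  then obtain a where a: "\<And>b. b \<in> Basis \<Longrightarrow> a b \<in> F"
    "eventually (\<lambda>q. \<forall>c\<in>Basis. (\<Sum>b\<in>Basis. a b q * g (E b) (E c) q) = \<xi> (E c) q) (nhds p)" by blast
  define X where "X = (\<Sum>b\<in>Basis. fsmul (a b) (E b))"
  have X: "X \<in> VF" unfolding X_def by (intro VF_sum VF_fsmul fr a)
  have gX: "g X (E c) q = (\<Sum>b\<in>Basis. a b q * g (E b) (E c) q)" for c q
    unfolding X_def
    by (simp add: tensorial_sum[OF tl[OF fr(2)]] tensorial_fsmul[OF tl[OF fr(2)]] VF_fsmul a(1) fr(2) sum_fun_apply)
  \<comment> \<open>Expanding at \<open>q\<close> requires the frame relation on a neighbourhood of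
    \<open>q\<close>, not only at \<open>q\<close>.\<close>
  have "eventually (\<lambda>q. eventually (\<lambda>q. \<forall>X\<in>VF. \<forall>f\<in>F. X f q = (\<Sum>b\<in>Basis. X (xs b) q * E b f q)) (nhds q)) (nhds p)"
    using fr(4) by (simp add: eventually_eventually)
  then have "eventually (\<lambda>q. \<forall>Y\<in>VF. g X Y q = \<xi> Y q) (nhds p)"
    using a(2)
  proof eventually_elim
    case (elim q)
    show ?case
    proof
      fix Y assume Y: "Y \<in> VF"
      show "g X Y q = \<xi> Y q"
        using tensorial_frame_expansion[OF tr[OF X] Y fr(1,2) elim(1)]
          tensorial_frame_expansion[OF one_form_tensorial[OF \<xi>] Y fr(1,2) elim(1)] elim(2)
        by (simp add: gX)
    qed
  qed
  then show ?thesis using X by blast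
qed

lemma bilinear_represents_one_form:
  assumes g: "F_bilinear F VF fsmul g" "nondegenerate VF value_at g" and \<xi>: "\<xi> \<in> one_forms A"
  shows "\<exists>X\<in>VF. \<forall>Y\<in>VF. g X Y = \<xi> Y"
proof -
  note tl = bilinear_tensorial(1)[OF g(1)]
  have "\<forall>p. \<exists>X. X \<in> VF \<and> eventually (\<lambda>q. \<forall>Y\<in>VF. g X Y q = \<xi> Y q) (nhds p)"
    using bilinear_represents_one_form_locally[OF g \<xi>] by blast
  then obtain V where "\<forall>p. V p \<in> VF \<and> eventually (\<lambda>q. \<forall>Y\<in>VF. g (V p) Y q = \<xi> Y q) (nhds p)"
    by (rule choice[THEN exE])
  then have V: "V p \<in> VF" "eventually (\<lambda>q. \<forall>Y\<in>VF. g (V p) Y q = \<xi> Y q) (nhds p)" for p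
    by blast+
  have Vq: "g (V q) Y q = \<xi> Y q" if "Y \<in> VF" for q Y
    using eventually_nhds_x_imp_x[OF V(2)] that by blast
  \<comment> \<open>A diagonal definition: the value at \<open>q\<close> comes from the solution
    chosen for \<open>q\<close>. The algebraic laws of a derivation are inherited point by point;
    smoothness comes from \<open>loc\<close>.\<close>
  define X :: "'m vector_field" where "X f q = V q f q" for f q
  have loc: "eventually (\<lambda>q. \<forall>f. X f q = V p f q) (nhds p)" for p
    using V(2)[of p]
  proof eventually_elim
    case (elim q)
    \<comment> \<open>For \<open>q\<close> near \<open>p\<close> both \<open>V p\<close> and
      \<open>V q\<close> solve the equation at \<open>q\<close>, so their difference is null there,
      and nondegeneracy makes them agree.\<close>
    have "\<forall>Y\<in>VF. g (V p - V q) Y q = 0"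
      using elim Vq by (simp add: tensorial_diff[OF tl] V(1))
    then have "value_at q (V p - V q) = 0"
      using g(2) VF_diff[OF V(1) V(1)] unfolding nondegenerate_def by blast
    then have "(V p - V q) f q = 0" for f by (metis value_at_def zero_fun_apply)
    then show ?case by (simp add: X_def)
  qed
  have X: "X \<in> VF"
    unfolding vector_fields_def
  proof (intro CollectI conjI ballI allI impI)
    fix f assume f: "f \<in> F"
    show "X f \<in> F"
    proof (rule smooth_functions_local)
      fix p
      show "\<exists>h\<in>F. eventually (\<lambda>q. X f q = h q) (nhds p)"
        using loc[of p] by (intro bexI[of _ "V p f"] VF_apply_smooth[OF V(1) f]) (auto elim: eventually_mono)
    qed
  qed (auto simp: X_def fun_eq_iff VF_apply_add[OF V(1)] VF_apply_scaleR[OF V(1)] VF_apply_mult[OF V(1)] VF_apply_undefined[OF V(1)])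
  have "g X Y p = \<xi> Y p" if Y: "Y \<in> VF" for Y p
  proof -
    \<comment> \<open>\<open>X\<close> and \<open>V p\<close> are the same tangent vector at
      \<open>p\<close>, and a function-linear map sees no more than that.\<close>
    have "value_at p (X - V p) = 0" by (simp add: value_at_def X_def fun_eq_iff)
    then have "g (X - V p) Y p = 0"
      by (rule tensorial_pointwise[OF tl[OF Y] VF_diff[OF X V(1)]])
    then show ?thesis using Vq[OF Y, of p] by (simp add: tensorial_diff[OF tl[OF Y] X V(1)])
  qed
  then show ?thesis using X by blast
qed

text \<open>A general form \<open>b\<close> is allowed because the result serves both
  \<open>g\<close> and its twin metric.\<close>

lemma flat_bij_betw:
  assumes b: "F_bilinear F VF fsmul b" "nondegenerate VF value_at b"
  shows "bij_betw (flat A b) VF (one_forms A)"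
  unfolding bij_betw_def
proof
  note t = bilinear_tensorial[OF b(1)]
  show "inj_on (flat A b) VF"
  proof (rule inj_onI)
    fix X Y assume XY: "X \<in> VF" "Y \<in> VF" "flat A b X = flat A b Y"
    have "b (X - Y) Z p = 0" if "Z \<in> VF" for Z p
      using fun_cong[OF XY(3), of Z] that XY by (simp add: flat_def tensorial_diff[OF t(1)])
    then have "value_at p (X - Y) = 0" for p
      using b(2) VF_diff[OF XY(1,2)] unfolding nondegenerate_def by blast
    then have "(X - Y) f p = 0" for f p by (metis value_at_def zero_fun_apply)
    then show "X = Y" by (simp add: fun_eq_iff)
  qed
  show "flat A b ` VF = one_forms A"
  proof (intro equalityI subsetI)
    fix \<xi> assume "\<xi> \<in> flat A b ` VF"
    then obtain X where X: "X \<in> VF" "\<xi> = flat A b X" by blast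
    show "\<xi> \<in> one_forms A"
      using X(1) b(1)
      by (auto simp: X(2) one_forms_def flat_def F_bilinear_def VF_add VF_fsmul)
  next
    fix \<xi> assume \<xi>: "\<xi> \<in> one_forms A"
    obtain X where X: "X \<in> VF" "\<forall>Y\<in>VF. b X Y = \<xi> Y"
      using bilinear_represents_one_form[OF b \<xi>] by blast
    have "flat A b X = \<xi>"
      using X(2) \<xi> by (auto simp: flat_def fun_eq_iff one_forms_def)
    then show "\<xi> \<in> flat A b ` VF" using X(1) by blast
  qed
qed

lemma sharp_flat:
  assumes "F_bilinear F VF fsmul b" "nondegenerate VF value_at b" "X \<in> VF"
  shows "sharp A b (flat A b X) = X"
  unfolding sharp_def using flat_bij_betw[OF assms(1,2)] assms(3)
  by (simp add: the_inv_into_f_f bij_betw_def)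

end


subsection \<open>The generalized structure\<close>

text \<open>The fibres are subsets of function spaces, and the projection used later is injective on
  the fibre only. A basis of \<open>V\<close> has its span inside \<open>V\<close>, so its image
  stays independent and is a basis of the image.\<close>

lemma dim_image_inj_on:
  fixes f :: "'a::real_vector \<Rightarrow> 'b::real_vector"
  assumes V: "subspace V" and f: "linear f" "inj_on f V"
  shows "dim (f ` V) = dim V"
proof -
  obtain B where B: "B \<subseteq> V" "independent B" "V \<subseteq> span B" "card B = dim V"
    by (rule basis_exists)
  have "span B \<subseteq> V" using B(1) V by (rule span_minimal)
  then have "independent (f ` B)"
    using linear_independent_injective_image[OF f(1) B(2)] inj_on_subset[OF f(2)] by blast
  moreover have "f ` V \<subseteq> span (f ` B)"
    using B(3) linear_span_image[OF f(1), of B] by auto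
  ultimately have "card (f ` B) = dim (f ` V)"
    using B(1) by (intro basis_card_eq_dim) auto
  then show ?thesis using card_image[OF inj_on_subset[OF f(2) B(1)]] B(4) by simp
qed

lemma F_linear_scaleR:
  assumes "F_linear F S sm T" "(\<lambda>_. c) \<in> F" "u \<in> S" "\<And>u. sm (\<lambda>_. c) u = c *\<^sub>R u"
  shows "T (c *\<^sub>R u) = c *\<^sub>R T u"
  using assms by (metis F_linear_def)

lemma fsmul_const: "fsmul (\<lambda>_. c) X = c *\<^sub>R X"
  by (simp add: fun_eq_iff)

lemma fsmul_add: "fsmul f (X + Y) = fsmul f X + fsmul f Y"
  and fsmul_scaleR: "fsmul f (c *\<^sub>R X) = c *\<^sub>R fsmul f X"
  by (simp_all add: fun_eq_iff algebra_simps)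

text \<open>The Riemannian and pseudo-Riemannian cases are merged through nondegeneracy. The value
  \<open>\<alpha> = -1\<close> is built into \<open>J_J\<close>, while \<open>\<epsilon>\<close>
  stays free, since the equivalence concerns both signs.\<close>

locale almost_complex_metric_manifold = manifold A
  for A :: "('m::{t2_space, second_countable_topology}, 'e::euclidean_space) chart set" +
  fixes \<epsilon> :: real and J :: "'m vector_field \<Rightarrow> 'm vector_field"
    and g :: "'m vector_field \<Rightarrow> 'm vector_field \<Rightarrow> 'm \<Rightarrow> real"
  assumes g_bilinear: "F_bilinear F VF fsmul g"
    and g_sym: "X \<in> VF \<Longrightarrow> Y \<in> VF \<Longrightarrow> g X Y = g Y X"
    and g_nondegenerate: "nondegenerate VF value_at g"
    and J_linear: "F_linear F VF fsmul J"
    and J_J: "X \<in> VF \<Longrightarrow> J (J X) = - X"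
    and g_J_J: "X \<in> VF \<Longrightarrow> Y \<in> VF \<Longrightarrow> g (J X) (J Y) = \<epsilon> *\<^sub>R g X Y"
    and \<epsilon>: "\<epsilon> \<in> {1, -1}"
begin

section \<open>Calculus with \<open>J\<close>, \<open>g\<close> and \<open>\<flat>\<close>\<close>

abbreviation flat_g (\<open>\<flat>\<close>) where "\<flat> \<equiv> flat A g"

lemma J_VF: "X \<in> VF \<Longrightarrow> J X \<in> VF"
  and J_add: "X \<in> VF \<Longrightarrow> Y \<in> VF \<Longrightarrow> J (X + Y) = J X + J Y"
  and J_fsmul: "f \<in> F \<Longrightarrow> X \<in> VF \<Longrightarrow> J (fsmul f X) = fsmul f (J X)"
  using J_linear by (auto simp: F_linear_def)

lemma J_scaleR: "X \<in> VF \<Longrightarrow> J (c *\<^sub>R X) = c *\<^sub>R J X"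
  using J_fsmul[OF smooth_const, of X c] by (simp add: fsmul_const)

lemma J_uminus: "X \<in> VF \<Longrightarrow> J (- X) = - J X"
  using J_scaleR[of X "-1"] by simp

lemmas VF_closed = VF_add VF_scaleR VF_uminus VF_diff VF_fsmul VF_zero J_VF

lemma J_diff: "X \<in> VF \<Longrightarrow> Y \<in> VF \<Longrightarrow> J (X - Y) = J X - J Y"
  using J_add[of X "- Y"] by (simp add: J_uminus VF_uminus)

lemmas J_simps = J_add J_diff J_scaleR J_uminus J_J J_fsmul

lemmas g_tensorial = bilinear_tensorial[OF g_bilinear]

lemma g_add: "X \<in> VF \<Longrightarrow> Y \<in> VF \<Longrightarrow> Z \<in> VF \<Longrightarrow> g (X + Y) Z = g X Z + g Y Z"
    "X \<in> VF \<Longrightarrow> Y \<in> VF \<Longrightarrow> Z \<in> VF \<Longrightarrow> g Z (X + Y) = g Z X + g Z Y"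
  and g_diff: "X \<in> VF \<Longrightarrow> Y \<in> VF \<Longrightarrow> Z \<in> VF \<Longrightarrow> g (X - Y) Z = g X Z - g Y Z"
    "X \<in> VF \<Longrightarrow> Y \<in> VF \<Longrightarrow> Z \<in> VF \<Longrightarrow> g Z (X - Y) = g Z X - g Z Y"
  and g_scaleR: "X \<in> VF \<Longrightarrow> Z \<in> VF \<Longrightarrow> g (c *\<^sub>R X) Z = c *\<^sub>R g X Z"
    "X \<in> VF \<Longrightarrow> Z \<in> VF \<Longrightarrow> g Z (c *\<^sub>R X) = c *\<^sub>R g Z X"
  and g_fsmul: "f \<in> F \<Longrightarrow> X \<in> VF \<Longrightarrow> Z \<in> VF \<Longrightarrow> g (fsmul f X) Z = f * g X Z"
    "f \<in> F \<Longrightarrow> X \<in> VF \<Longrightarrow> Z \<in> VF \<Longrightarrow> g Z (fsmul f X) = f * g Z X"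
  by (rule tensorial_add[OF g_tensorial(1)] tensorial_add[OF g_tensorial(2)]
      tensorial_diff[OF g_tensorial(1)] tensorial_diff[OF g_tensorial(2)]
      tensorial_scaleR[OF g_tensorial(1)] tensorial_scaleR[OF g_tensorial(2)]
      tensorial_fsmul[OF g_tensorial(1)] tensorial_fsmul[OF g_tensorial(2)]; assumption)+

lemma g_uminus: "X \<in> VF \<Longrightarrow> Z \<in> VF \<Longrightarrow> g (- X) Z = - g X Z"
    "X \<in> VF \<Longrightarrow> Z \<in> VF \<Longrightarrow> g Z (- X) = - g Z X"
  using g_scaleR[of X Z "-1"] by simp_all

lemmas g_simps = g_add g_diff g_scaleR g_uminus g_fsmul

lemma g_smooth: "X \<in> VF \<Longrightarrow> Y \<in> VF \<Longrightarrow> g X Y \<in> F"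
  using g_bilinear by (auto simp: F_bilinear_def)

lemma g_J_left:
  assumes "X \<in> VF" "Y \<in> VF"
  shows "g (J X) Y = - (\<epsilon> *\<^sub>R g X (J Y))"
proof -
  \<comment> \<open>This is \<open>g_J_J\<close> with \<open>J Y\<close> in place of
    \<open>Y\<close>.\<close>
  have "- g (J X) Y = \<epsilon> *\<^sub>R g X (J Y)"
    using g_J_J[OF assms(1) J_VF[OF assms(2)]] assms by (simp add: J_J g_simps J_VF)
  then show ?thesis by (metis minus_minus)
qed

lemma g_nondegenerateD:
  "X \<in> VF \<Longrightarrow> (\<And>Y. Y \<in> VF \<Longrightarrow> g X Y p = 0) \<Longrightarrow> value_at p X = 0"
  using g_nondegenerate unfolding nondegenerate_def by blast

lemma g_null_at: "X \<in> VF \<Longrightarrow> Y \<in> VF \<Longrightarrow> value_at p X = 0 \<Longrightarrow> g X Y p = 0"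
  using tensorial_pointwise[OF g_tensorial(1)] by blast

text \<open>Scalar factors of \<open>g\<close> can be compared only where \<open>g\<close> is
  nonzero; this supplies such a place for reading off \<open>\<epsilon>\<close>.\<close>

lemma g_not_zero: "\<exists>X\<in>VF. \<exists>Y\<in>VF. g X Y p \<noteq> 0"
  using ex_nonvanishing_vector_field[of p] g_nondegenerateD by blast

lemma flat_apply: "Y \<in> VF \<Longrightarrow> \<flat> X Y = g X Y"
  by (simp add: flat_def)

lemma flat_one_form: "X \<in> VF \<Longrightarrow> \<flat> X \<in> one_forms A"
  by (auto simp: one_forms_def flat_def g_smooth g_simps VF_closed)

lemma flat_linear:
  "X \<in> VF \<Longrightarrow> Y \<in> VF \<Longrightarrow> \<flat> (X + Y) = \<flat> X + \<flat> Y"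
  "X \<in> VF \<Longrightarrow> Y \<in> VF \<Longrightarrow> \<flat> (X - Y) = \<flat> X - \<flat> Y"
  "X \<in> VF \<Longrightarrow> \<flat> (c *\<^sub>R X) = c *\<^sub>R \<flat> X"
  "X \<in> VF \<Longrightarrow> \<flat> (- X) = - \<flat> X"
  "f \<in> F \<Longrightarrow> X \<in> VF \<Longrightarrow> \<flat> (fsmul f X) = fsmul f (\<flat> X)"
  by (auto simp: fun_eq_iff flat_def g_simps)

lemma sharp_g: "X \<in> VF \<Longrightarrow> sharp A g (\<flat> X) = X"
  by (rule sharp_flat[OF g_bilinear g_nondegenerate])

lemma one_form_cases:
  assumes "\<xi> \<in> one_forms A"
  obtains Z where "Z \<in> VF" "\<xi> = \<flat> Z"
  using flat_bij_betw[OF g_bilinear g_nondegenerate] assms unfolding bij_betw_def by blast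

lemma gen_section_cases:
  assumes "u \<in> gen_sections A"
  obtains X Z where "X \<in> VF" "Z \<in> VF" "u = (X, \<flat> Z)"
  using assms one_form_cases unfolding gen_sections_def by blast

lemma gen_section_flat: "X \<in> VF \<Longrightarrow> Z \<in> VF \<Longrightarrow> (X, \<flat> Z) \<in> gen_sections A"
  by (simp add: gen_sections_def flat_one_form)

lemma flat_inject: "X \<in> VF \<Longrightarrow> Y \<in> VF \<Longrightarrow> \<flat> X = \<flat> Y \<longleftrightarrow> X = Y"
  by (metis sharp_g)

text \<open>The coefficient \<open>\<epsilon>\<close> compensates the sign picked up when
  \<open>J\<close> moves across \<open>g\<close>, so the lower right block acts as \<open>-J\<close>
  for either value of \<open>\<epsilon>\<close>.\<close>

lemma dual_map_flat: "Z \<in> VF \<Longrightarrow> \<epsilon> *\<^sub>R dual_map A J (\<flat> Z) = - \<flat> (J Z)"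
  using \<epsilon> by (auto simp: fun_eq_iff dual_map_def flat_def J_VF g_J_left)

lemma gen_F_flat:
  assumes "X \<in> VF" "Z \<in> VF"
  shows "gen_F A \<epsilon> J g (X, \<flat> Z) = (J X + sqrt 2 *\<^sub>R Z, \<flat> (sqrt 2 *\<^sub>R X - J Z))"
  using assms by (simp add: gen_F_def gen_matrix_def sharp_g dual_map_flat flat_linear VF_closed)

lemma gen_metric_flat:
  assumes "X \<in> VF" "Z \<in> VF" "Y \<in> VF" "W \<in> VF"
  shows "gen_metric A g (X, \<flat> Z) (Y, \<flat> W) = g X Y + g Z W"
  using assms by (simp add: gen_metric_def sharp_g)

lemma gen_section_add:
  assumes "X \<in> VF" "Z \<in> VF" "Y \<in> VF" "W \<in> VF"
  shows "(X, \<flat> Z) + (Y, \<flat> W) = (X + Y, \<flat> (Z + W))"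
  using assms by (simp add: flat_linear)

lemma gen_section_fsmul:
  assumes "f \<in> F" "X \<in> VF" "Z \<in> VF"
  shows "gen_fsmul f (X, \<flat> Z) = (fsmul f X, \<flat> (fsmul f Z))"
  using assms by (simp add: gen_fsmul_def flat_linear)

section \<open>The involution \<open>gen_F\<close> and its eigenbundles\<close>

lemma gen_F_linear: "F_linear F (gen_sections A) gen_fsmul (gen_F A \<epsilon> J g)"
  unfolding F_linear_def
proof (intro conjI ballI)
  fix u assume "u \<in> gen_sections A"
  then obtain X Z where u: "X \<in> VF" "Z \<in> VF" "u = (X, \<flat> Z)" by (rule gen_section_cases)
  show "gen_F A \<epsilon> J g u \<in> gen_sections A"
    using u by (simp add: gen_F_flat gen_section_flat VF_closed)
  {
    fix v assume "v \<in> gen_sections A"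
    then obtain Y W where v: "Y \<in> VF" "W \<in> VF" "v = (Y, \<flat> W)" by (rule gen_section_cases)
    show "gen_F A \<epsilon> J g (u + v) = gen_F A \<epsilon> J g u + gen_F A \<epsilon> J g v"
      unfolding u(3) v(3) gen_section_add[OF u(1,2) v(1,2)] gen_F_flat[OF u(1,2)] gen_F_flat[OF v(1,2)]
        gen_F_flat[OF VF_add[OF u(1) v(1)] VF_add[OF u(2) v(2)]]
      using u(1,2) v(1,2)
      by (simp add: VF_closed J_simps flat_linear algebra_simps)
  }
next
  fix f u assume f: "f \<in> F" and "u \<in> gen_sections A"
  then obtain X Z where u: "X \<in> VF" "Z \<in> VF" "u = (X, \<flat> Z)" by (metis gen_section_cases)
  have "fsmul f (X - Y) = fsmul f X - fsmul f Y" for X Y :: "'m vector_field"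
    by (simp add: fun_eq_iff algebra_simps)
  then show "gen_F A \<epsilon> J g (gen_fsmul f u) = gen_fsmul f (gen_F A \<epsilon> J g u)"
    using f u by (simp add: gen_section_fsmul gen_F_flat VF_closed J_simps fsmul_add fsmul_scaleR)
qed

text \<open>The diagonal of the square is \<open>J^2 + 2 = 1\<close>, which explains the constant
  \<open>sqrt 2\<close>; the off-diagonal terms cancel because the diagonal blocks are
  \<open>J\<close> and \<open>-J\<close>.\<close>

lemma gen_F_involution:
  assumes "u \<in> gen_sections A"
  shows "gen_F A \<epsilon> J g (gen_F A \<epsilon> J g u) = u"
proof -
  obtain X Z where u: "X \<in> VF" "Z \<in> VF" "u = (X, \<flat> Z)" using assms by (rule gen_section_cases)
  have "J (J X + sqrt 2 *\<^sub>R Z) + sqrt 2 *\<^sub>R (sqrt 2 *\<^sub>R X - J Z) = X"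
    "sqrt 2 *\<^sub>R (J X + sqrt 2 *\<^sub>R Z) - J (sqrt 2 *\<^sub>R X - J Z) = Z"
    using u(1,2) by (simp_all add: J_simps VF_closed scaleR_right_diff_distrib scaleR_right_distrib scaleR_2)
  then show ?thesis unfolding u(3) using u(1,2) by (simp add: gen_F_flat VF_closed)
qed

lemma gen_section_scaleR:
  assumes "X \<in> VF" "Z \<in> VF"
  shows "c *\<^sub>R (X, \<flat> Z) = (c *\<^sub>R X, \<flat> (c *\<^sub>R Z))"
  using assms by (simp add: flat_linear)

lemma gen_F_eigen_iff:
  assumes c: "c \<in> {1, -1::real}" and XZ: "X \<in> VF" "Z \<in> VF"
  shows "gen_F A \<epsilon> J g (X, \<flat> Z) = c *\<^sub>R (X, \<flat> Z) \<longleftrightarrow> Z = (1 / sqrt 2) *\<^sub>R (c *\<^sub>R X - J X)"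
    (is "?L \<longleftrightarrow> Z = ?Z")
proof -
  have "?L \<longleftrightarrow> J X + sqrt 2 *\<^sub>R Z = c *\<^sub>R X \<and> sqrt 2 *\<^sub>R X - J Z = c *\<^sub>R Z"
    unfolding gen_section_scaleR[OF XZ] using XZ by (simp add: gen_F_flat flat_inject VF_closed)
  moreover have "J X + sqrt 2 *\<^sub>R Z = c *\<^sub>R X \<longleftrightarrow> Z = ?Z"
  proof -
    have "J X + sqrt 2 *\<^sub>R Z = c *\<^sub>R X \<longleftrightarrow> sqrt 2 *\<^sub>R Z = sqrt 2 *\<^sub>R ?Z"
      by (simp add: algebra_simps)
    then show ?thesis by (simp only: scaleR_cancel_left) simp
  qed
  \<comment> \<open>The second eigenvector equation follows from the first, by
    \<open>J (J X) = - X\<close>, \<open>c * c = 1\<close> and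
    \<open>sqrt 2 = 2 / sqrt 2\<close>.\<close>
  moreover have "sqrt 2 *\<^sub>R X - J ?Z = c *\<^sub>R ?Z"
  proof -
    have s: "sqrt 2 *\<^sub>R X = (1 / sqrt 2) *\<^sub>R (X + X)"
      by (simp add: scaleR_2[symmetric] real_div_sqrt)
    have JZ: "J ?Z = (1 / sqrt 2) *\<^sub>R (c *\<^sub>R J X + X)"
      using XZ by (simp add: J_simps VF_closed)
    have cZ: "c *\<^sub>R ?Z = (1 / sqrt 2) *\<^sub>R (X - c *\<^sub>R J X)"
      using c by (auto simp: scaleR_right_diff_distrib)
    show ?thesis
      unfolding s JZ cZ by (simp only: scaleR_right_diff_distrib[symmetric] add_diff_cancel_right)
  qed
  ultimately show ?thesis by blast
qed

lemma gen_value_add: "gen_value_at p (u + v) = gen_value_at p u + gen_value_at p v"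
  and gen_value_scaleR: "gen_value_at p (c *\<^sub>R u) = c *\<^sub>R gen_value_at p u"
  by (simp_all add: gen_value_at_def value_at_def prod_eq_iff fun_eq_iff)

lemma gen_sections_add: "u \<in> gen_sections A \<Longrightarrow> v \<in> gen_sections A \<Longrightarrow> u + v \<in> gen_sections A"
  by (metis gen_section_cases gen_section_add gen_section_flat VF_add)

lemma gen_sections_scaleR: "u \<in> gen_sections A \<Longrightarrow> c *\<^sub>R u \<in> gen_sections A"
  by (metis gen_section_cases gen_section_scaleR gen_section_flat VF_scaleR)

lemma gen_F_scaleR: "u \<in> gen_sections A \<Longrightarrow> gen_F A \<epsilon> J g (c *\<^sub>R u) = c *\<^sub>R gen_F A \<epsilon> J g u"
  by (rule F_linear_scaleR[OF gen_F_linear smooth_const])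
    (simp_all add: gen_fsmul_def fsmul_const prod_eq_iff)

lemma subspace_gen_eigenfibre: "subspace (gen_eigenfibre A (gen_F A \<epsilon> J g) c p)"
proof -
  let ?E = "{u \<in> gen_sections A. gen_F A \<epsilon> J g u = c *\<^sub>R u}"
  have add: "u + v \<in> ?E" if "u \<in> ?E" "v \<in> ?E" for u v
    using that gen_F_linear by (auto simp: F_linear_def gen_sections_add scaleR_add_right)
  have scale: "k *\<^sub>R u \<in> ?E" if "u \<in> ?E" for k u
    using that by (auto simp: gen_F_scaleR gen_sections_scaleR scaleR_left_commute)
  have "(0, \<flat> 0) \<in> gen_sections A" by (intro gen_section_flat VF_zero)
  then have "0 *\<^sub>R (0, \<flat> 0) \<in> ?E"
    using gen_F_scaleR[of "(0, \<flat> 0)" 0] gen_sections_scaleR[of "(0, \<flat> 0)" 0]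
    by (simp add: zero_prod_def)
  then have "gen_value_at p (0 *\<^sub>R (0, \<flat> 0)) \<in> gen_value_at p ` ?E" by blast
  then have zero: "0 \<in> gen_value_at p ` ?E"
    unfolding gen_value_scaleR by simp
  show ?thesis
    unfolding subspace_def gen_eigenfibre_def
  proof (intro conjI ballI allI zero)
    fix a b assume "a \<in> gen_value_at p ` ?E" "b \<in> gen_value_at p ` ?E"
    then obtain u v where uv: "u \<in> ?E" "v \<in> ?E" "a = gen_value_at p u" "b = gen_value_at p v" by blast
    show "a + b \<in> gen_value_at p ` ?E"
      unfolding uv(3,4) gen_value_add[symmetric] by (rule imageI[OF add[OF uv(1,2)]])
  next
    fix k a assume "a \<in> gen_value_at p ` ?E"
    then obtain u where u: "u \<in> ?E" "a = gen_value_at p u" by blast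
    show "k *\<^sub>R a \<in> gen_value_at p ` ?E"
      unfolding u(2) gen_value_scaleR[symmetric] by (rule imageI[OF scale[OF u(1)]])
  qed
qed

text \<open>Both eigenbundles are graphs over the tangent bundle.\<close>

lemma dim_gen_eigenfibre:
  assumes c: "c \<in> {1, -1::real}"
  shows "dim (gen_eigenfibre A (gen_F A \<epsilon> J g) c p) = dim (value_at p ` VF)"
proof -
  let ?V = "gen_eigenfibre A (gen_F A \<epsilon> J g) c p"
  let ?Z = "\<lambda>X. (1 / sqrt 2) *\<^sub>R (c *\<^sub>R X - J X)"
  have V: "?V = (\<lambda>X. gen_value_at p (X, \<flat> (?Z X))) ` VF"
  proof (intro equalityI subsetI)
    fix w assume "w \<in> ?V"
    then obtain u where u: "u \<in> gen_sections A" "gen_F A \<epsilon> J g u = c *\<^sub>R u" "w = gen_value_at p u"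
      by (auto simp: gen_eigenfibre_def)
    obtain X Z where XZ: "X \<in> VF" "Z \<in> VF" "u = (X, \<flat> Z)" using u(1) by (rule gen_section_cases)
    have "Z = ?Z X" using u(2) gen_F_eigen_iff[OF c XZ(1,2)] unfolding XZ(3) by blast
    then show "w \<in> (\<lambda>X. gen_value_at p (X, \<flat> (?Z X))) ` VF"
      using XZ(1) u(3) unfolding XZ(3) by blast
  next
    fix w assume "w \<in> (\<lambda>X. gen_value_at p (X, \<flat> (?Z X))) ` VF"
    then obtain X where X: "X \<in> VF" "w = gen_value_at p (X, \<flat> (?Z X))" by blast
    have Z: "?Z X \<in> VF" using X(1) by (intro VF_closed)
    show "w \<in> ?V"
      unfolding gen_eigenfibre_def X(2)
      using gen_section_flat[OF X(1) Z] gen_F_eigen_iff[OF c X(1) Z] by blast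
  qed
  have inj: "inj_on fst ?V"
  proof (rule inj_onI)
    fix v w assume vw: "v \<in> ?V" "w \<in> ?V" "fst v = fst w"
    then obtain X Y where XY: "X \<in> VF" "Y \<in> VF" "v = gen_value_at p (X, \<flat> (?Z X))"
      "w = gen_value_at p (Y, \<flat> (?Z Y))" unfolding V by blast
    have "value_at p X = value_at p Y" using vw(3) by (simp add: XY gen_value_at_def)
    then have "value_at p (X - Y) = 0" by (simp add: value_at_def fun_eq_iff)
    then have z: "g (X - Y) T p = 0" if "T \<in> VF" for T
      using that XY by (intro g_null_at VF_closed)
    \<comment> \<open>\<open>J\<close> preserves vanishing at \<open>p\<close>, since it can be
      moved across \<open>g\<close> onto the test field. Hence the value of \<open>X\<close> at
      \<open>p\<close> determines that of \<open>\<flat> (?Z X)\<close>, and projecting the fibre to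
      its tangent part is injective.\<close>
    have "g (J (X - Y)) T p = 0" if "T \<in> VF" for T
      using z[OF J_VF[OF that]] that XY by (simp add: g_J_left VF_closed)
    then have "g (?Z X) T p = g (?Z Y) T p" if "T \<in> VF" for T
      using z[OF that] that XY(1,2) by (simp add: J_simps g_simps VF_closed)
    then have "\<flat> (?Z X) T p = \<flat> (?Z Y) T p" for T
      by (simp add: flat_def)
    then show "v = w"
      using \<open>value_at p X = value_at p Y\<close> unfolding XY gen_value_at_def value_at_def by simp
  qed
  have "linear (fst :: (('m \<Rightarrow> real) \<Rightarrow> real) \<times> ('m vector_field \<Rightarrow> real) \<Rightarrow> _)"
    by (rule linearI) simp_all
  then have "dim (fst ` ?V) = dim ?V"
    using inj by (rule dim_image_inj_on[OF subspace_gen_eigenfibre])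
  moreover have "fst ` ?V = value_at p ` VF"
    unfolding V image_image by (simp add: gen_value_at_def)
  ultimately show ?thesis by simp
qed

lemma gen_F_almost_paracomplex: "gen_almost_paracomplex A (gen_F A \<epsilon> J g)"
  unfolding gen_almost_paracomplex_def
  by (simp add: gen_F_linear gen_F_involution dim_gen_eigenfibre)

section \<open>Compatibility with the generalized metric\<close>

lemma gen_metric_gen_F:
  assumes "\<epsilon> = -1" "u \<in> gen_sections A" "v \<in> gen_sections A"
  shows "gen_metric A g (gen_F A \<epsilon> J g u) (gen_F A \<epsilon> J g v) = gen_metric A g u v"
proof -
  obtain X Z where u: "X \<in> VF" "Z \<in> VF" "u = (X, \<flat> Z)" using assms(2) by (rule gen_section_cases)
  obtain Y W where v: "Y \<in> VF" "W \<in> VF" "v = (Y, \<flat> W)" using assms(3) by (rule gen_section_cases)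
  have sqrt2: "sqrt 2 * (sqrt 2 * t) = 2 * t" for t
    by (simp add: mult.assoc[symmetric])
  \<comment> \<open>The pure terms carry the factor \<open>\<epsilon> + 2 = 1\<close>. The mixed
    terms, all with factor \<open>sqrt 2\<close>, cancel in pairs because \<open>J\<close> is
    self-adjoint for \<open>\<epsilon> = -1\<close>.\<close>
  have "g (J X + sqrt 2 *\<^sub>R Z) (J Y + sqrt 2 *\<^sub>R W) + g (sqrt 2 *\<^sub>R X - J Z) (sqrt 2 *\<^sub>R Y - J W)
      = g X Y + g Z W"
    using u(1,2) v(1,2) assms(1)
    by (simp add: fun_eq_iff g_simps VF_closed g_J_J) (simp add: g_J_left VF_closed J_J g_simps algebra_simps sqrt2)
  then show ?thesis
    unfolding u(3) v(3) using u(1,2) v(1,2) by (simp add: gen_F_flat gen_metric_flat VF_closed)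
qed

lemma gen_compatible_iff: "gen_compatible A (gen_F A \<epsilon> J g) (gen_metric A g) \<longleftrightarrow> \<epsilon> = -1"
proof
  assume "gen_compatible A (gen_F A \<epsilon> J g) (gen_metric A g)"
  then obtain \<delta> :: real where \<delta>: "\<delta> \<in> {1, -1}" "\<And>u v. u \<in> gen_sections A \<Longrightarrow> v \<in> gen_sections A \<Longrightarrow>
      gen_metric A g (gen_F A \<epsilon> J g u) (gen_F A \<epsilon> J g v) = \<delta> *\<^sub>R gen_metric A g u v"
    unfolding gen_compatible_def by blast
  obtain X Y p where XY: "X \<in> VF" "Y \<in> VF" "g X Y p \<noteq> 0" using g_not_zero by blast
  have J0: "J 0 = 0" using J_scaleR[OF VF_zero, of 0] by simp
  have g0: "g 0 0 = 0" using g_scaleR(1)[OF VF_zero VF_zero, of 0] by simp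
  \<comment> \<open>Sections without covector part suffice as a test: \<open>(X, \<flat> 0)\<close>
    is sent to \<open>(J X, \<flat> (sqrt 2 *\<^sub>R X))\<close>.\<close>
  have "gen_metric A g (gen_F A \<epsilon> J g (X, \<flat> 0)) (gen_F A \<epsilon> J g (Y, \<flat> 0)) p
      = (\<delta> *\<^sub>R gen_metric A g (X, \<flat> 0) (Y, \<flat> 0)) p"
    using XY by (simp only: \<delta>(2) gen_section_flat VF_zero)
  then have "(\<epsilon> + 2) * g X Y p = \<delta> * g X Y p"
    using XY(1,2) by (simp add: gen_F_flat gen_metric_flat VF_closed J0 g0 g_J_J g_simps algebra_simps)
  then show "\<epsilon> = -1" using XY(3) \<delta>(1) \<epsilon> by auto
next
  assume "\<epsilon> = -1"
  then show "gen_compatible A (gen_F A \<epsilon> J g) (gen_metric A g)"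
    unfolding gen_compatible_def using gen_metric_gen_F by (intro bexI[of _ 1]) auto
qed

lemma gen_metric_pseudo_riemannian:
  assumes "\<epsilon> = -1"
  shows "pseudo_riemannian_metric F (gen_sections A) gen_fsmul gen_value_at (gen_metric A g)"
  unfolding pseudo_riemannian_metric_def
proof (intro conjI ballI)
  let ?G = "gen_metric A g"
  show "F_bilinear F (gen_sections A) gen_fsmul ?G"
    unfolding F_bilinear_def
  proof (intro conjI ballI)
    fix u v assume uv: "u \<in> gen_sections A" "v \<in> gen_sections A"
    obtain X Z where u: "X \<in> VF" "Z \<in> VF" "u = (X, \<flat> Z)" using uv(1) by (rule gen_section_cases)
    obtain Y W where v: "Y \<in> VF" "W \<in> VF" "v = (Y, \<flat> W)" using uv(2) by (rule gen_section_cases)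
    show "?G u v \<in> F" using u v by (simp add: gen_metric_flat smooth_add g_smooth)
    {
      fix w assume "w \<in> gen_sections A"
      then obtain S T where w: "S \<in> VF" "T \<in> VF" "w = (S, \<flat> T)" by (rule gen_section_cases)
      show "?G (u + v) w = ?G u w + ?G v w" "?G w (u + v) = ?G w u + ?G w v"
        unfolding u(3) v(3) w(3) gen_section_add[OF u(1,2) v(1,2)]
        using u v w by (simp_all add: gen_metric_flat VF_closed g_simps)
    }
    show "?G (gen_fsmul f u) v = f * ?G u v" "?G u (gen_fsmul f v) = f * ?G u v" if "f \<in> F" for f
      using u v that
      by (simp_all add: gen_section_fsmul gen_metric_flat VF_closed g_simps distrib_left)
  qed
  show "?G u v = ?G v u" if uv: "u \<in> gen_sections A" "v \<in> gen_sections A" for u v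
  proof -
    obtain X Z where u: "X \<in> VF" "Z \<in> VF" "u = (X, \<flat> Z)" using uv(1) by (rule gen_section_cases)
    obtain Y W where v: "Y \<in> VF" "W \<in> VF" "v = (Y, \<flat> W)" using uv(2) by (rule gen_section_cases)
    show ?thesis using u v by (simp add: gen_metric_flat g_sym[of Y X] g_sym[of W Z])
  qed
  show "nondegenerate (gen_sections A) gen_value_at ?G"
    unfolding nondegenerate_def
  proof (intro allI ballI impI)
    fix p u assume "u \<in> gen_sections A" and G0: "\<forall>v\<in>gen_sections A. ?G u v p = 0"
    obtain X Z where u: "X \<in> VF" "Z \<in> VF" "u = (X, \<flat> Z)"
      using \<open>u \<in> gen_sections A\<close> by (rule gen_section_cases)
    have sum0: "g X Y p + g Z W p = 0" if "Y \<in> VF" "W \<in> VF" for Y W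
    proof -
      have "?G (X, \<flat> Z) (Y, \<flat> W) p = 0" using G0 gen_section_flat[OF that] u(3) by blast
      then show ?thesis using that u by (simp add: gen_metric_flat)
    qed
    have g0: "g Y 0 p = 0" if "Y \<in> VF" for Y using g_scaleR(2)[OF VF_zero that, of 0] by simp
    \<comment> \<open>Testing against sections with one component zero separates the vector part
      from the covector part.\<close>
    have "value_at p X = 0"
      using sum0[OF _ VF_zero] g0 u by (intro g_nondegenerateD) auto
    moreover have "g Z Y p = 0" if "Y \<in> VF" for Y
      using sum0[OF VF_zero that] g0 u by simp
    then have "value_at p (\<flat> Z) = 0"
      by (auto simp: value_at_def flat_def fun_eq_iff)
    ultimately show "gen_value_at p u = 0" by (simp add: u(3) gen_value_at_def zero_prod_def)
  qed
  \<comment> \<open>Positivity would restrict to \<open>g\<close> on vector fields, but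
    \<open>g (J X) (J X) = - g X X\<close> shows that \<open>g\<close> takes both signs.\<close>
  show "\<not> positive_definite (gen_sections A) gen_value_at ?G"
  proof
    fix p :: 'm
    assume pd: "positive_definite (gen_sections A) gen_value_at ?G"
    have pos: "g X X p > 0" if "X \<in> VF" "value_at p X \<noteq> 0" for X
    proof -
      have "gen_value_at p (X, \<flat> 0) \<noteq> 0" using that by (simp add: gen_value_at_def zero_prod_def)
      then have "?G (X, \<flat> 0) (X, \<flat> 0) p > 0"
        using pd gen_section_flat[OF that(1) VF_zero] unfolding positive_definite_def by blast
      moreover have "g 0 0 = 0" using g_scaleR(1)[OF VF_zero VF_zero, of 0] by simp
      ultimately show ?thesis using that VF_zero by (simp add: gen_metric_flat)
    qed
    obtain X where X: "X \<in> VF" "value_at p X \<noteq> 0" using ex_nonvanishing_vector_field by blast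
    have neg: "g (J X) (J X) p = - g X X p" using g_J_J[OF X(1) X(1)] assms by simp
    \<comment> \<open>If \<open>J X\<close> vanished at \<open>p\<close>, so would
      \<open>g (J X) (J X) p\<close> and hence \<open>g X X p\<close>, which is positive.\<close>
    then have "value_at p (J X) \<noteq> 0"
      using pos[OF X] g_null_at[OF J_VF[OF X(1)] J_VF[OF X(1)]] by force
    then show False using pos[OF X] pos[OF J_VF[OF X(1)]] neg by simp
  qed
qed

section \<open>Twin metrics on the tangent and generalized tangent bundles\<close>

lemma twin_metric_bilinear: "F_bilinear F VF fsmul (twin_metric g J)"
  unfolding F_bilinear_def twin_metric_def
  by (simp add: g_smooth J_VF J_simps g_simps VF_closed)

text \<open>Testing against \<open>J Y\<close> returns \<open>\<epsilon>\<close> times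
  \<open>g X Y\<close>, so a vector null for the twin metric is null for \<open>g\<close>. This
  makes the sharp map of the twin metric a genuine inverse.\<close>

lemma twin_metric_nondegenerate: "nondegenerate VF value_at (twin_metric g J)"
  unfolding nondegenerate_def twin_metric_def
proof (intro allI ballI impI)
  fix p X assume X: "X \<in> VF" and z: "\<forall>Y\<in>VF. g (J X) Y p = 0"
  have "g X Y p = 0" if "Y \<in> VF" for Y
  proof -
    have "\<epsilon> * g X Y p = 0" using z J_VF[OF that] g_J_J[OF X that] by (metis real_scaleR_def scaleR_fun_apply)
    then show ?thesis using \<epsilon> by auto
  qed
  then show "value_at p X = 0" by (rule g_nondegenerateD[OF X])
qed

text \<open>The field \<open>- J Z\<close> represents \<open>\<flat> Z\<close> in the twin metric
  because \<open>J (- J Z) = Z\<close>.\<close>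

lemma sharp_twin_flat:
  assumes "Z \<in> VF"
  shows "sharp A (twin_metric g J) (\<flat> Z) = - J Z"
proof -
  have "flat A (twin_metric g J) (- J Z) = \<flat> Z"
    using assms by (simp add: flat_def fun_eq_iff twin_metric_def J_simps VF_closed)
  then show ?thesis
    using sharp_flat[OF twin_metric_bilinear twin_metric_nondegenerate, of "- J Z"] assms
    by (simp add: VF_closed)
qed

lemma twin_gen_metric:
  assumes "\<epsilon> = -1" "X \<in> VF" "Y \<in> VF" "\<xi> \<in> one_forms A" "\<eta> \<in> one_forms A"
  defines "\<phi> \<equiv> twin_metric g J"
  shows "twin_metric (gen_metric A g) (gen_F A \<epsilon> J g) (X, \<xi>) (Y, \<eta>)
    = (2 * sqrt 2) *\<^sub>R gen_metric0 (X, \<xi>) (Y, \<eta>) + \<phi> X Y + \<phi> (sharp A \<phi> \<xi>) (sharp A \<phi> \<eta>)"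
proof -
  obtain Z where Z: "Z \<in> VF" "\<xi> = \<flat> Z" using assms(4) by (rule one_form_cases)
  obtain W where W: "W \<in> VF" "\<eta> = \<flat> W" using assms(5) by (rule one_form_cases)
  note VF = assms(2,3) Z(1) W(1)
  have T1: "twin_metric (gen_metric A g) (gen_F A \<epsilon> J g) (X, \<xi>) (Y, \<eta>) =
      g (J X) Y + sqrt 2 *\<^sub>R g Z Y + sqrt 2 *\<^sub>R g X W - g (J Z) W"
    unfolding twin_metric_def Z(2) W(2)
    using VF by (simp add: gen_F_flat gen_metric_flat VF_closed g_simps)
  \<comment> \<open>The factor \<open>2 * sqrt 2\<close> absorbs the \<open>1/2\<close> in
    \<open>gen_metric0\<close> and leaves exactly the mixed terms of \<open>T1\<close>.\<close>
  have T2: "(2 * sqrt 2) *\<^sub>R gen_metric0 (X, \<xi>) (Y, \<eta>) = sqrt 2 *\<^sub>R g Z Y + sqrt 2 *\<^sub>R g X W"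
    using VF by (simp add: gen_metric0_def Z(2) W(2) flat_apply g_sym[of W X] scaleR_right_distrib)
  \<comment> \<open>The left side is \<open>g (J (- J Z)) (- J W)\<close>, that is
    \<open>- g Z (J W)\<close>; self-adjointness of \<open>J\<close> for
    \<open>\<epsilon> = -1\<close> turns it into the covector term of \<open>T1\<close>.\<close>
  have T3: "\<phi> (sharp A \<phi> \<xi>) (sharp A \<phi> \<eta>) = - g (J Z) W"
    using VF assms(1)
    by (simp add: \<phi>_def Z(2) W(2) sharp_twin_flat) (simp add: fun_eq_iff twin_metric_def J_simps g_simps VF_closed g_J_left)
  show ?thesis
    unfolding T1 T2 T3 by (simp add: \<phi>_def twin_metric_def fun_eq_iff)
qed

end

lemma metric_manifold_imp_almost_complex:
  assumes "metric_manifold A (-1) \<epsilon> J g"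
  shows "almost_complex_metric_manifold A \<epsilon> J g"
proof -
  \<comment> \<open>A null vector is tested against itself.\<close>
  have "nondegenerate S ev b" if "positive_definite S ev b"
    for S :: "'a vector_field set" and ev :: "'a \<Rightarrow> 'a vector_field \<Rightarrow> ('a \<Rightarrow> real) \<Rightarrow> real" and b
    using that unfolding positive_definite_def nondegenerate_def by (metis less_irrefl)
  then show ?thesis
    using assms unfolding metric_manifold_def riemannian_metric_def pseudo_riemannian_metric_def
    by unfold_locales auto
qed

theorem proposition4p17:
  fixes A :: "('m::{t2_space, second_countable_topology}, 'e::euclidean_space) chart set"
    and \<alpha> \<epsilon> :: real
    and J :: "'m vector_field \<Rightarrow> 'm vector_field"
    and g \<phi> :: "'m vector_field \<Rightarrow> 'm vector_field \<Rightarrow> 'm \<Rightarrow> real"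
  assumes "metric_manifold A \<alpha> \<epsilon> J g"
    and "\<alpha> = -1"
    and "\<phi> = twin_metric g J"
  shows "gen_almost_paracomplex A (gen_F A \<epsilon> J g)
    \<and> (gen_compatible A (gen_F A \<epsilon> J g) (gen_metric A g) \<longleftrightarrow> \<epsilon> = -1)
    \<and> (\<epsilon> = -1 \<longleftrightarrow> almost_norden A J g)
    \<and> (\<epsilon> = -1 \<longrightarrow>
        gen_pseudo_riemannian_almost_product A (gen_F A \<epsilon> J g) (gen_metric A g)
        \<and> nondegenerate (vector_fields A) value_at \<phi>
        \<and> (\<forall>X\<in>vector_fields A. \<forall>Y\<in>vector_fields A. \<forall>\<xi>\<in>one_forms A. \<forall>\<eta>\<in>one_forms A.
             twin_metric (gen_metric A g) (gen_F A \<epsilon> J g) (X, \<xi>) (Y, \<eta>)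
             = (2 * sqrt 2) *\<^sub>R gen_metric0 (X, \<xi>) (Y, \<eta>) + \<phi> X Y
               + \<phi> (sharp A \<phi> \<xi>) (sharp A \<phi> \<eta>)))"
proof -
  interpret almost_complex_metric_manifold A \<epsilon> J g
    using assms(1,2) metric_manifold_imp_almost_complex by blast
  \<comment> \<open>If the manifold is almost Norden, \<open>g\<close> scales under \<open>J\<close>
    both by \<open>\<epsilon>\<close> and by \<open>-1\<close>; a nonzero value of \<open>g\<close>
    forces the two to agree.\<close>
  have norden: "\<epsilon> = -1 \<longleftrightarrow> almost_norden A J g"
  proof
    assume "almost_norden A J g"
    then have neg: "g (J X) (J Y) = - g X Y" if "X \<in> VF" "Y \<in> VF" for X Y
      using that by (simp add: almost_norden_def metric_manifold_def)
    obtain X Y p where XY: "X \<in> VF" "Y \<in> VF" "g X Y p \<noteq> 0" using g_not_zero by blast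
    have "\<epsilon> * g X Y p = - g X Y p"
      using fun_cong[OF neg[OF XY(1,2)], of p] XY by (simp add: g_J_J)
    then show "\<epsilon> = -1" using XY(3) \<epsilon> by auto
  qed (use assms in \<open>simp add: almost_norden_def\<close>)
  show ?thesis
    using gen_F_almost_paracomplex gen_compatible_iff norden twin_metric_nondegenerate
      gen_F_linear gen_F_involution gen_metric_pseudo_riemannian gen_metric_gen_F twin_gen_metric
    unfolding gen_pseudo_riemannian_almost_product_def assms(3) by simp
qed

end
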